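(* Let $(X,\mu)$ be a standard probability space and let $T$ be an ergodic automorphism of $(X,\mu)$. Let $\rho$ and $\tilde\rho$ be two summable admissible semimetrics on $(X,\mu)$, each of which is generating for $(X,\mu,T)$. Then $\mathcal{H}(X,\mu,T,\rho)=\mathcal{H}(X,\mu,T,\tilde\rho)$; that is, a sequence of positive numbers is a scaling sequence for $\rho$ if and only if it is a scaling sequence for $\tilde\rho$.
   Context: A standard probability space is a Lebesgue--Rokhlin space; its measure may have atoms. An automorphism is an invertible (mod 0) measure-preserving transformation. A semimetric $\rho$ on $X$ is a nonnegative symmetric function on $X\times X$ that vanishes on the diagonal and satisfies the triangle inequality (distinct points may be at distance $0$). It is measurable if it is measurable on $(X^2,\mu^2)$ as a function of two variables. A measurable semimetric is admissible if there is a subset $X_1\subset X$ of full measure such that the semimetric space $(X_1,\rho)$ is separable. It is summable if $\int_{X\times X}\rho\,d(\mu\times\mu)<\infty$. Epsilon-entropy: for $\varepsilon>0$ let $k\in\mathbb{N}=\{1,2,\dots\}$ be the least number such that $X$ can be partitioned into disjoint measurable sets $X_0,X_1,\dots,X_k$ with $\mu(X_0)<\varepsilon$ and with the $\rho$-diameter of $X_j$ less than $\varepsilon$ for each $j=1,\dots,k$. Put $\mathbb{H}_\varepsilon(X,\mu,\rho)=\log_2 k$, and $\mathbb{H}_\varepsilon(X,\mu,\rho)=+\infty$ if no such $k$ exists. For $k\in\mathbb{Z}$ put $T^k\rho(x,y)=\rho(T^kx,T^ky)$, and for $n\ge 1$ put $T^n_{av}\rho=\frac1n\sum_{k=0}^{n-1}T^k\rho$.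 A measurable semimetric $\rho$ is (two-sided) generating for $(X,\mu,T)$ if there is a measurable set $X'\subset X$ of full measure such that for any two distinct $x,y\in X'$ there exists $k\in\mathbb{Z}$ with $T^k\rho(x,y)>0$. For an admissible semimetric $\rho$, a sequence $\{h_n\}$ of positive numbers is a scaling sequence for $\rho$ if for every $\varepsilon>0$ one has $\limsup_n \mathbb{H}_\varepsilon(X,\mu,T^n_{av}\rho)/h_n<+\infty$, and for all sufficiently small $\varepsilon>0$ one has $\liminf_n \mathbb{H}_\varepsilon(X,\mu,T^n_{av}\rho)/h_n>0$. The class of all scaling sequences for $\rho$ is denoted $\mathcal{H}(X,\mu,T,\rho)$ (it may be empty). *)

theory Defs
  imports "HOL-Probability.Probability"
begin

section \<open>Lebesgue--Rokhlin spaces and their automorphisms\<close>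

definition full_measure :: "'a measure \<Rightarrow> 'a set \<Rightarrow> bool" where
  "full_measure M A \<longleftrightarrow> A \<in> sets M \<and> emeasure M (space M - A) = 0"

definition isomorphic_mod0 :: "'a measure \<Rightarrow> 'b measure \<Rightarrow> bool" where
  "isomorphic_mod0 M N \<longleftrightarrow> (\<exists>A B f.
     full_measure M A \<and> full_measure N B \<and> bij_betw f A B \<and>
     f \<in> restrict_space M A \<rightarrow>\<^sub>M restrict_space N B \<and>
     inv_into A f \<in> restrict_space N B \<rightarrow>\<^sub>M restrict_space M A \<and>
     distr (restrict_space M A) (restrict_space N B) f = restrict_space N B)"

text \<open>
  The complete probability spaces that are isomorphic mod 0 to the disjoint union of an interval
  with Lebesgue measure (\<open>c = 0\<close> if \<open>M\<close> is purely atomic) and countably many atoms.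
  The set \<open>D\<close> consists of the atoms (points of measure zero are harmless).
\<close>
definition standard_prob_space :: "'a measure \<Rightarrow> bool" where
  "standard_prob_space M \<longleftrightarrow> prob_space M \<and> complete_measure M \<and>
     (\<exists>D (c :: real). countable D \<and> D \<subseteq> space M \<and> (\<forall>x\<in>D. {x} \<in> sets M) \<and> 0 \<le> c \<and>
        isomorphic_mod0 (restrict_space M (space M - D)) (lebesgue_on {0..c}))"

definition measure_preserving_map :: "'a measure \<Rightarrow> ('a \<Rightarrow> 'a) \<Rightarrow> bool" where
  "measure_preserving_map M T \<longleftrightarrow> T \<in> M \<rightarrow>\<^sub>M M \<and> distr M M T = M"

definition inverse_mod0 :: "'a measure \<Rightarrow> ('a \<Rightarrow> 'a) \<Rightarrow> ('a \<Rightarrow> 'a) \<Rightarrow> bool" where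
  "inverse_mod0 M T S \<longleftrightarrow> S \<in> M \<rightarrow>\<^sub>M M \<and> (AE x in M. S (T x) = x) \<and> (AE x in M. T (S x) = x)"

definition automorphism_mod0 :: "'a measure \<Rightarrow> ('a \<Rightarrow> 'a) \<Rightarrow> bool" where
  "automorphism_mod0 M T \<longleftrightarrow> measure_preserving_map M T \<and> (\<exists>S. inverse_mod0 M T S)"

definition ergodic :: "'a measure \<Rightarrow> ('a \<Rightarrow> 'a) \<Rightarrow> bool" where
  "ergodic M T \<longleftrightarrow>
     (\<forall>A\<in>sets M. T -` A \<inter> space M = A \<longrightarrow> emeasure M A = 0 \<or> emeasure M (space M - A) = 0)"

text \<open>
  An inverse mod 0 of an automorphism is unique only up to equality almost everywhere, so negative
  powers depend on the choice made here on a null set. This does not affect the notion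
  \<open>generating\<close> below, which is insensitive to null sets.
\<close>
definition inv_mod0 :: "'a measure \<Rightarrow> ('a \<Rightarrow> 'a) \<Rightarrow> 'a \<Rightarrow> 'a" where
  "inv_mod0 M T = (SOME S. inverse_mod0 M T S)"

definition int_iterate :: "'a measure \<Rightarrow> ('a \<Rightarrow> 'a) \<Rightarrow> int \<Rightarrow> 'a \<Rightarrow> 'a" where
  "int_iterate M T k = (if k \<ge> 0 then T ^^ nat k else inv_mod0 M T ^^ nat (- k))"


section \<open>Semimetrics\<close>

definition semimetric_on :: "'a set \<Rightarrow> ('a \<Rightarrow> 'a \<Rightarrow> real) \<Rightarrow> bool" where
  "semimetric_on X \<rho> \<longleftrightarrow>
     (\<forall>x\<in>X. \<forall>y\<in>X. 0 \<le> \<rho> x y \<and> \<rho> x y = \<rho> y x) \<and>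
     (\<forall>x\<in>X. \<rho> x x = 0) \<and>
     (\<forall>x\<in>X. \<forall>y\<in>X. \<forall>z\<in>X. \<rho> x z \<le> \<rho> x y + \<rho> y z)"

definition separable_semimetric :: "'a set \<Rightarrow> ('a \<Rightarrow> 'a \<Rightarrow> real) \<Rightarrow> bool" where
  "separable_semimetric X \<rho> \<longleftrightarrow>
     (\<exists>D. countable D \<and> D \<subseteq> X \<and> (\<forall>x\<in>X. \<forall>e>0. \<exists>d\<in>D. \<rho> x d < e))"

text \<open>
  As a Lebesgue--Rokhlin space, the square of \<open>M\<close> carries the completed product measure;
  \<open>M \<Otimes>\<^sub>M M\<close> itself need not be complete.
\<close>
definition measurable_semimetric :: "'a measure \<Rightarrow> ('a \<Rightarrow> 'a \<Rightarrow> real) \<Rightarrow> bool" where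
  "measurable_semimetric M \<rho> \<longleftrightarrow>
     semimetric_on (space M) \<rho> \<and>
     (\<lambda>(x, y). \<rho> x y) \<in> borel_measurable (completion (M \<Otimes>\<^sub>M M))"

definition admissible :: "'a measure \<Rightarrow> ('a \<Rightarrow> 'a \<Rightarrow> real) \<Rightarrow> bool" where
  "admissible M \<rho> \<longleftrightarrow> measurable_semimetric M \<rho> \<and>
     (\<exists>X\<^sub>1. full_measure M X\<^sub>1 \<and> separable_semimetric X\<^sub>1 \<rho>)"

definition summable_semimetric :: "'a measure \<Rightarrow> ('a \<Rightarrow> 'a \<Rightarrow> real) \<Rightarrow> bool" where
  "summable_semimetric M \<rho> \<longleftrightarrow>
     (\<integral>\<^sup>+ (x, y). ennreal (\<rho> x y) \<partial>completion (M \<Otimes>\<^sub>M M)) < \<infinity>"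

definition shift_semimetric ::
    "'a measure \<Rightarrow> ('a \<Rightarrow> 'a) \<Rightarrow> int \<Rightarrow> ('a \<Rightarrow> 'a \<Rightarrow> real) \<Rightarrow> 'a \<Rightarrow> 'a \<Rightarrow> real" where
  "shift_semimetric M T k \<rho> x y = \<rho> (int_iterate M T k x) (int_iterate M T k y)"

definition average_semimetric ::
    "'a measure \<Rightarrow> ('a \<Rightarrow> 'a) \<Rightarrow> nat \<Rightarrow> ('a \<Rightarrow> 'a \<Rightarrow> real) \<Rightarrow> 'a \<Rightarrow> 'a \<Rightarrow> real" where
  "average_semimetric M T n \<rho> x y = (\<Sum>k<n. shift_semimetric M T (int k) \<rho> x y) / real n"

definition generating :: "'a measure \<Rightarrow> ('a \<Rightarrow> 'a) \<Rightarrow> ('a \<Rightarrow> 'a \<Rightarrow> real) \<Rightarrow> bool" where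
  "generating M T \<rho> \<longleftrightarrow>
     (\<exists>X'. full_measure M X' \<and>
        (\<forall>x\<in>X'. \<forall>y\<in>X'. x \<noteq> y \<longrightarrow> (\<exists>k::int. shift_semimetric M T k \<rho> x y > 0)))"


section \<open>Epsilon-entropy and scaling sequences\<close>

definition semimetric_diameter :: "('a \<Rightarrow> 'a \<Rightarrow> real) \<Rightarrow> 'a set \<Rightarrow> ennreal" where
  "semimetric_diameter \<rho> A = (SUP (x, y)\<in>A \<times> A. ennreal (\<rho> x y))"

definition eps_partition ::
    "'a measure \<Rightarrow> ('a \<Rightarrow> 'a \<Rightarrow> real) \<Rightarrow> real \<Rightarrow> nat \<Rightarrow> (nat \<Rightarrow> 'a set) \<Rightarrow> bool" where
  "eps_partition M \<rho> \<epsilon> k X \<longleftrightarrow>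
     (\<forall>j\<le>k. X j \<in> sets M) \<and> disjoint_family_on X {..k} \<and> (\<Union>j\<le>k. X j) = space M \<and>
     emeasure M (X 0) < ennreal \<epsilon> \<and>
     (\<forall>j\<in>{1..k}. semimetric_diameter \<rho> (X j) < ennreal \<epsilon>)"

definition eps_entropy :: "'a measure \<Rightarrow> ('a \<Rightarrow> 'a \<Rightarrow> real) \<Rightarrow> real \<Rightarrow> ereal" where
  "eps_entropy M \<rho> \<epsilon> =
     (if \<exists>k\<ge>1. \<exists>X. eps_partition M \<rho> \<epsilon> k X
      then ereal (log 2 (real (LEAST k. k \<ge> 1 \<and> (\<exists>X. eps_partition M \<rho> \<epsilon> k X))))
      else \<infinity>)"

text \<open>Sequences are indexed by \<open>n \<ge> 1\<close>; the value \<open>h 0\<close> is irrelevant.\<close>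
definition scaling_sequences ::
    "'a measure \<Rightarrow> ('a \<Rightarrow> 'a) \<Rightarrow> ('a \<Rightarrow> 'a \<Rightarrow> real) \<Rightarrow> (nat \<Rightarrow> real) set" where
  "scaling_sequences M T \<rho> = {h. (\<forall>n\<ge>1. 0 < h n) \<and>
     (\<forall>\<epsilon>>0. limsup (\<lambda>n. eps_entropy M (average_semimetric M T n \<rho>) \<epsilon> / ereal (h n)) < \<infinity>) \<and>
     (\<forall>\<^sub>F \<epsilon> in at_right 0.
        liminf (\<lambda>n. eps_entropy M (average_semimetric M T n \<rho>) \<epsilon> / ereal (h n)) > 0)}"

end

theory Submission
  imports Defs
begin

text \<open>
  The point is that, for every \<open>\<epsilon> > 0\<close>, a second semimetric is Lipschitz with respect to the first up
  to a small error: there are \<open>K\<close>, \<open>C\<close> and an integrable \<open>g \<ge> 0\<close> with \<open>\<integral>g \<le> \<epsilon>\<close> such that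
  \<open>\<rho>' x y \<le> C \<cdot> (\<Sum>\<bar>k\<bar>\<le>K. \<rho> (T\<^sup>k x) (T\<^sup>k y)) + g x + g y + \<epsilon>\<close>. Indeed, cover most of the space by finitely
  many \<open>\<rho>'\<close>-balls of radius \<open>\<epsilon>/2\<close>. As \<open>\<rho>\<close> is generating, compactness separates each ball from its
  complement, off a set of small measure, by a positive \<open>\<rho>\<close>-distance along finitely many iterates.

  Averaging along the orbit replaces \<open>g\<close> by its Birkhoff averages, whose integral is still at most
  \<open>\<epsilon>\<close>, and the shifts by \<open>\<bar>k\<bar> \<le> K\<close> cost only boundary terms of integral \<open>O(K/n)\<close>. By Markov's
  inequality a \<open>\<delta>\<close>-partition for the averages of \<open>\<rho>\<close> becomes an \<open>\<epsilon>\<close>-partition for the averages of \<open>\<rho>'\<close>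
  with the same number of pieces, for all large \<open>n\<close>.
\<close>

section \<open>Inner compactness and finite separation\<close>

lemma full_measure_iff_AE:
  "full_measure M A \<longleftrightarrow> A \<in> sets M \<and> (AE x in M. x \<in> A)"
proof -
  have "{x \<in> space M. x \<notin> A} = space M - A" by auto
  then show ?thesis
    by (auto simp: full_measure_def AE_iff_measurable[OF _ refl])
qed

text \<open>This lemma stands in for a topology on the space. The isomorphism with an interval and
  an enumeration of \<open>D\<close> combine to an injection \<open>J\<close> into the reals. Inner
  regularity of Lebesgue measure handles the continuous part, finitely many points carry nearly all
  the mass of \<open>D\<close>, and a compact set together with a finite set is compact.\<close>

lemma standard_prob_space_inner_compact:
  assumes "standard_prob_space M"
  obtains Y and J :: "'a \<Rightarrow> real" where
    "full_measure M Y" "inj_on J Y"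
    "\<And>E d. E \<in> sets M \<Longrightarrow> d > 0 \<Longrightarrow> \<exists>C. compact C \<and> C \<subseteq> J ` (E \<inter> Y) \<and>
       J -` C \<inter> Y \<in> sets M \<and> measure M (E - J -` C \<inter> Y) < d"
proof -
  from assms obtain D and c :: real where M: "prob_space M" and D: "countable D" "D \<subseteq> space M"
    and D1: "\<And>x. x \<in> D \<Longrightarrow> {x} \<in> sets M"
    and iso: "isomorphic_mod0 (restrict_space M (space M - D)) (lebesgue_on {0..c})"
    by (auto simp: standard_prob_space_def)
  interpret prob_space M by fact
  have DM [measurable]: "D \<in> sets M"
    using D D1 by (metis sets.countable)
  define M' where "M' = restrict_space M (space M - D)"
  define N where "N = lebesgue_on {0..c}"
  obtain A B f where AB: "full_measure M' A" "full_measure N B" and bij: "bij_betw f A B"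
    and f: "f \<in> restrict_space M' A \<rightarrow>\<^sub>M restrict_space N B"
    and g: "inv_into A f \<in> restrict_space N B \<rightarrow>\<^sub>M restrict_space M' A"
    and distr: "distr (restrict_space M' A) (restrict_space N B) f = restrict_space N B"
    using iso unfolding isomorphic_mod0_def M'_def N_def by blast
  have spM': "space M' = space M - D" by (auto simp: M'_def space_restrict_space)
  have setsM': "X \<in> sets M' \<longleftrightarrow> X \<in> sets M \<and> X \<subseteq> space M - D" for X
    unfolding M'_def by (subst sets_restrict_space_iff) auto
  have A [measurable]: "A \<in> sets M" and AD: "A \<subseteq> space M - D"
    using AB(1) by (auto simp: full_measure_def setsM')
  have A0: "emeasure M (space M - D - A) = 0"
    using AB(1) unfolding full_measure_def spM' unfolding M'_def
    by (subst (asm) emeasure_restrict_space) auto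
  have setsM'A: "X \<in> sets (restrict_space M' A) \<longleftrightarrow> X \<in> sets M \<and> X \<subseteq> A" for X
    using AB(1) AD by (subst sets_restrict_space_iff) (auto simp: full_measure_def setsM')
  have spN: "space N = {0..c}" by (auto simp: N_def)
  have BN: "B \<in> sets N" using AB(2) by (simp add: full_measure_def)
  then have B: "B \<subseteq> {0..c}" "B \<in> sets lebesgue"
    by (auto simp: N_def sets_restrict_space_iff)
  have setsNB: "X \<in> sets (restrict_space N B) \<longleftrightarrow> X \<in> sets lebesgue \<and> X \<subseteq> B" for X
    using BN B unfolding N_def by (subst sets_restrict_space_iff) (auto simp: sets_restrict_space_iff)
  have emNB: "emeasure (restrict_space N B) X = emeasure lebesgue X" if "X \<in> sets lebesgue" "X \<subseteq> B" for X
    using that B BN emeasure_restrict_space[of B N X] emeasure_restrict_space[of "{0..c}" lebesgue X]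
    by (simp add: N_def Int_absorb2)
  have spNB: "space (restrict_space N B) = B" using B by (auto simp: space_restrict_space spN)
  have spMA: "space (restrict_space M' A) = A" using AD by (auto simp: space_restrict_space spM')
  have emMA: "emeasure (restrict_space M' A) X = emeasure M X" if "X \<in> sets M" "X \<subseteq> A" for X
    using that AD AB(1) emeasure_restrict_space[of A M' X] emeasure_restrict_space[of "space M - D" M X]
    by (auto simp: M'_def full_measure_def Int_absorb2 space_restrict_space)
  \<comment> \<open>The isomorphism takes values in \<open>{0..c}\<close>, so sending the points of
    \<open>D\<close> to distinct negative integers keeps the two images disjoint and makes
    \<open>J\<close> injective on \<open>Y\<close>.\<close>
  define J where "J x = (if x \<in> D then - 1 - real (to_nat_on D x) else f x)" for x
  define Y where "Y = A \<union> D"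
  have fA: "f ` A = B" "inj_on f A" using bij by (auto simp: bij_betw_def)
  have full: "full_measure M Y"
  proof -
    have "space M - Y = space M - D - A" by (auto simp: Y_def)
    then show ?thesis using A0 by (auto simp: full_measure_def Y_def)
  qed
  have JA: "J x = f x" "f x \<ge> 0" if "x \<in> A" for x
    using that AD fA B by (auto simp: J_def)
  have JD: "J x = - 1 - real (to_nat_on D x)" if "x \<in> D" for x
    using that by (auto simp: J_def)
  have neq: "J x \<noteq> J y" if "x \<in> A" "y \<in> D" for x y
    using JA[OF that(1)] JD[OF that(2)] by auto
  have injJ: "inj_on J Y"
  proof (rule inj_onI)
    fix x y assume xy: "x \<in> Y" "y \<in> Y" "J x = J y"
    then consider "x \<in> A" "y \<in> A" | "x \<in> D" "y \<in> D"
      using neq[of x y] neq[of y x] by (auto simp: Y_def)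
    then show "x = y"
    proof cases
      case 1 then show ?thesis using xy(3) JA(1)[of x] JA(1)[of y] inj_onD[OF fA(2), of x y] by simp
    next
      case 2
      then have "to_nat_on D x = to_nat_on D y" using xy(3) JD[of x] JD[of y] by simp
      then show ?thesis using 2 D(1) by simp
    qed
  qed
  show thesis
  proof (rule that[OF full injJ])
    fix E and d :: real assume E [measurable]: "E \<in> sets M" and d: "d > 0"
    \<comment> \<open>The tails \<open>S n\<close> of the enumeration decrease to the empty set, so
      their measures tend to 0 and a finite initial part suffices.\<close>
    have "\<exists>F. finite F \<and> F \<subseteq> E \<inter> D \<and> measure M (E \<inter> D - F) < d / 2"
    proof -
      define S where "S n = {x \<in> E \<inter> D. n \<le> to_nat_on D x}" for n
      have Ssets: "S n \<in> sets M" for n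
      proof (rule sets.countable)
        show "countable (S n)" by (rule countable_subset[OF _ D(1)]) (auto simp: S_def)
      qed (auto simp: S_def D1)
      have "(\<lambda>n. measure M (S n)) \<longlonglongrightarrow> measure M (\<Inter>n. S n)"
      proof (rule finite_Lim_measure_decseq)
        show "range S \<subseteq> events" using Ssets by blast
        show "decseq S" by (auto simp: S_def decseq_def)
      qed
      moreover have "(\<Inter>n. S n) = {}"
      proof -
        have "x \<notin> S (Suc (to_nat_on D x))" for x by (simp add: S_def)
        then show ?thesis by blast
      qed
      ultimately have "(\<lambda>n. measure M (S n)) \<longlonglongrightarrow> 0" by simp
      then have "\<forall>\<^sub>F n in sequentially. measure M (S n) < d / 2"
        using d by (intro order_tendstoD(2)) auto
      then obtain n where n: "measure M (S n) < d / 2"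
        by (auto simp: eventually_sequentially)
      let ?F = "{x \<in> E \<inter> D. to_nat_on D x < n}"
      have "finite ?F"
      proof (rule finite_imageD)
        show "finite (to_nat_on D ` ?F)" by (rule finite_subset[of _ "{..<n}"]) auto
        show "inj_on (to_nat_on D) ?F"
          using inj_on_to_nat_on[OF D(1)] by (rule inj_on_subset) auto
      qed
      moreover have "E \<inter> D - ?F = S n" by (auto simp: S_def)
      ultimately show ?thesis using n by (intro exI[of _ ?F]) auto
    qed
    then obtain F where F: "finite F" "F \<subseteq> E \<inter> D" "measure M (E \<inter> D - F) < d / 2" by blast
    have [measurable]: "F \<in> sets M"
      using F(2) D1 by (intro sets.countable[OF _ countable_finite[OF F(1)]]) auto
    \<comment> \<open>The image is the preimage of \<open>E \<inter> A\<close> under the measurable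
      inverse of \<open>f\<close>, so inner regularity applies to it.\<close>
    have imE: "f ` (E \<inter> A) \<in> sets lebesgue" "f ` (E \<inter> A) \<subseteq> B"
    proof -
      have "inv_into A f -` (E \<inter> A) \<inter> space (restrict_space N B) \<in> sets (restrict_space N B)"
        by (rule measurable_sets[OF g]) (simp add: setsM'A)
      also have "inv_into A f -` (E \<inter> A) \<inter> space (restrict_space N B) = f ` (E \<inter> A)"
        unfolding spNB
      proof (intro equalityI subsetI)
        fix x assume x: "x \<in> inv_into A f -` (E \<inter> A) \<inter> B"
        then have "f (inv_into A f x) = x" using fA(1) by (simp add: f_inv_into_f)
        then show "x \<in> f ` (E \<inter> A)" using x by (metis IntD1 imageI vimageE)
      next
        fix y assume "y \<in> f ` (E \<inter> A)"
        then obtain x where x: "x \<in> E" "x \<in> A" "y = f x" by auto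
        then show "y \<in> inv_into A f -` (E \<inter> A) \<inter> B"
          using inv_into_f_f[OF fA(2) x(2)] fA(1) by auto
      qed
      finally show "f ` (E \<inter> A) \<in> sets lebesgue" by (simp add: setsNB)
      show "f ` (E \<inter> A) \<subseteq> B" using fA by auto
    qed
    obtain C where C: "closed C" "C \<subseteq> f ` (E \<inter> A)" "emeasure lebesgue (f ` (E \<inter> A) - C) < ennreal (d / 2)"
      using sets_lebesgue_inner_closed[OF imE(1) half_gt_zero[OF d]] by blast
    have Cleb: "C \<in> sets lebesgue" using borel_closed[OF C(1)] by simp
    have CB: "C \<subseteq> B" using C imE by auto
    have compC: "compact C"
      using C(1) bounded_subset[OF bounded_closed_interval order_trans[OF CB B(1)]]
      by (simp add: compact_eq_bounded_closed)
    \<comment> \<open>Since \<open>f\<close> carries the measure on \<open>A\<close> to Lebesgue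
      measure on \<open>B\<close>, an error made in the interval has the same size in
      \<open>M\<close>.\<close>
    have pre: "f -` X \<inter> A \<in> sets M" "emeasure M (f -` X \<inter> A) = emeasure lebesgue X" if "X \<in> sets lebesgue" "X \<subseteq> B" for X
    proof -
      have X: "X \<in> sets (restrict_space N B)" using that by (simp add: setsNB)
      have "f -` X \<inter> A \<in> sets (restrict_space M' A)"
        using measurable_sets[OF f X] by (simp add: spMA)
      then show *: "f -` X \<inter> A \<in> sets M" by (simp add: setsM'A)
      have "emeasure lebesgue X = emeasure (distr (restrict_space M' A) (restrict_space N B) f) X"
        using that by (simp add: distr emNB)
      also have "\<dots> = emeasure (restrict_space M' A) (f -` X \<inter> A)"
        by (subst emeasure_distr[OF f X]) (simp add: spMA)
      also have "\<dots> = emeasure M (f -` X \<inter> A)" using * by (simp add: emMA)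
      finally show "emeasure M (f -` X \<inter> A) = emeasure lebesgue X" by simp
    qed
    let ?C = "C \<union> J ` F"
    have "compact ?C" using compact_Un[OF compC finite_imp_compact[OF finite_imageI[OF F(1)]]] .
    moreover have "?C \<subseteq> J ` (E \<inter> Y)"
    proof -
      have "f ` (E \<inter> A) = J ` (E \<inter> A)" using JA by (auto simp: image_iff)
      then show ?thesis using C F by (auto simp: Y_def)
    qed
    moreover have eq: "J -` ?C \<inter> Y = (f -` C \<inter> A) \<union> F"
    proof -
      have n1: "x \<in> F" if "x \<in> D" "J x \<in> J ` F" for x
        using that injJ F(2) by (auto simp: Y_def inj_on_def)
      have n2: "J x \<notin> J ` F" if "x \<in> A" for x
        using neq[OF that] F(2) by auto
      have n3: "J x \<notin> C" if "x \<in> D" for x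
        using neq[OF _ that] CB fA JA by (metis image_iff subsetD)
      show ?thesis
      proof (intro set_eqI)
        fix x
        consider "x \<in> A" "x \<notin> D" "x \<notin> F" | "x \<in> D" "x \<notin> A" | "x \<notin> A" "x \<notin> D" "x \<notin> F"
          using AD F(2) by auto
        then show "x \<in> J -` ?C \<inter> Y \<longleftrightarrow> x \<in> (f -` C \<inter> A) \<union> F"
        proof cases
          case 1
          then show ?thesis using n2[of x] JA(1)[of x] by (simp add: Y_def)
        next
          case 2
          then show ?thesis using n1[of x] n3[of x] by (auto simp: Y_def)
        next
          case 3
          then show ?thesis by (simp add: Y_def)
        qed
      qed
    qed
    moreover have "(f -` C \<inter> A) \<union> F \<in> sets M" using pre[OF Cleb CB] by auto
    moreover have "measure M (E - ((f -` C \<inter> A) \<union> F)) < d"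
    proof -
      let ?G = "f -` (f ` (E \<inter> A) - C) \<inter> A"
      have G: "?G \<in> sets M" "emeasure M ?G < ennreal (d / 2)"
        using pre[OF sets.Diff[OF imE(1) Cleb] order_trans[OF Diff_subset imE(2)]] C(3) by simp_all
      have G': "measure M ?G < d / 2"
        using G(2) d by (simp add: emeasure_eq_measure ennreal_less_iff)
      have "measure M (E - ((f -` C \<inter> A) \<union> F)) \<le> measure M ((?G \<union> (E \<inter> D - F)) \<union> (space M - D - A))"
        using G(1) sets.sets_into_space[OF E] by (intro finite_measure_mono) auto
      also have "\<dots> \<le> measure M (?G \<union> (E \<inter> D - F)) + measure M (space M - D - A)"
        using G(1) by (intro measure_Un_le) auto
      also have "\<dots> \<le> measure M ?G + measure M (E \<inter> D - F) + measure M (space M - D - A)"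
        using G(1) by (intro add_right_mono measure_Un_le) auto
      also have "measure M (space M - D - A) = 0" using A0 by (simp add: measure_def)
      finally show ?thesis using G' F(3) by simp
    qed
    ultimately show "\<exists>C. compact C \<and> C \<subseteq> J ` (E \<inter> Y) \<and>
       J -` C \<inter> Y \<in> sets M \<and> measure M (E - J -` C \<inter> Y) < d"
      by (intro exI[of _ ?C]) (simp only: eq simp_thms)
  qed
qed

text \<open>Compactness turns countably many separating sets into finitely many. Each set and its
  complement are approximated from inside by compacts \<open>C i\<close> and \<open>D i\<close>, and
  the points lost go into \<open>Z\<close>. A pair in \<open>C 0 \<times> D 0\<close> comes from two
  distinct points, which some \<open>E i\<close> separates, so it lies in the open set
  \<open>U i\<close>; finitely many of these sets cover the product.\<close>

lemma separating_sequence_finite_subfamily: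
  fixes E :: "nat \<Rightarrow> 'a set"
  assumes std: "standard_prob_space M"
    and E [measurable]: "\<And>i. E i \<in> sets M"
    and X: "full_measure M X"
    and sep: "\<And>x y. x \<in> X \<Longrightarrow> y \<in> X \<Longrightarrow> x \<noteq> y \<Longrightarrow> \<exists>i. (x \<in> E i) \<noteq> (y \<in> E i)"
    and A [measurable]: "A \<in> sets M" and d: "d > 0"
  obtains Z N where "Z \<in> sets M" "measure M Z < d"
    "\<And>x y. x \<in> A - Z \<Longrightarrow> y \<in> space M - A - Z \<Longrightarrow> \<exists>i<N::nat. (x \<in> E i) \<noteq> (y \<in> E i)"
proof -
  interpret prob_space M using std by (simp add: standard_prob_space_def)
  obtain Y and J :: "'a \<Rightarrow> real" where Y: "full_measure M Y" and inj: "inj_on J Y"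
    and J: "\<And>E d. E \<in> sets M \<Longrightarrow> d > 0 \<Longrightarrow> \<exists>C. compact C \<and> C \<subseteq> J ` (E \<inter> Y) \<and>
       J -` C \<inter> Y \<in> sets M \<and> measure M (E - J -` C \<inter> Y) < d"
    using standard_prob_space_inner_compact[OF std] by blast
  have [measurable]: "X \<in> sets M" "Y \<in> sets M"
    using X Y by (auto simp: full_measure_def)
  \<comment> \<open>Index 0 is kept for \<open>A\<close>, so \<open>E i\<close> is approximated by
    the compacts with index \<open>Suc i\<close>.\<close>
  define F where "F i = (case i of 0 \<Rightarrow> A | Suc j \<Rightarrow> E j)" for i
  have F [measurable]: "F i \<in> sets M" for i by (auto simp: F_def split: nat.split)
  \<comment> \<open>These losses, incurred twice for each \<open>i\<close>, add up to at most
    \<open>d / 2\<close>.\<close>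
  have d': "d / 4 * (1/2) ^ Suc i > 0" for i using d by simp
  have "\<exists>C. compact C \<and> C \<subseteq> J ` (F i \<inter> X \<inter> Y) \<and>
       J -` C \<inter> Y \<in> sets M \<and> measure M (F i \<inter> X - J -` C \<inter> Y) < d / 4 * (1/2) ^ Suc i" for i
    by (rule J[OF _ d']) measurable
  then obtain C where C: "\<And>i. compact (C i)" "\<And>i. C i \<subseteq> J ` (F i \<inter> X \<inter> Y)"
       "\<And>i. J -` C i \<inter> Y \<in> sets M" "\<And>i. measure M (F i \<inter> X - J -` C i \<inter> Y) < d / 4 * (1/2) ^ Suc i"
    by metis
  have "\<exists>C. compact C \<and> C \<subseteq> J ` ((X - F i) \<inter> Y) \<and>
       J -` C \<inter> Y \<in> sets M \<and> measure M ((X - F i) - J -` C \<inter> Y) < d / 4 * (1/2) ^ Suc i" for i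
    by (rule J[OF _ d']) measurable
  then obtain D where D: "\<And>i. compact (D i)" "\<And>i. D i \<subseteq> J ` ((X - F i) \<inter> Y)"
       "\<And>i. J -` D i \<inter> Y \<in> sets M" "\<And>i. measure M ((X - F i) - J -` D i \<inter> Y) < d / 4 * (1/2) ^ Suc i"
    by metis
  define W where "W i = (F i \<inter> X - J -` C i \<inter> Y) \<union> ((X - F i) - J -` D i \<inter> Y)" for i
  have W [measurable]: "W i \<in> sets M" for i
    unfolding W_def using C(3)[of i] D(3)[of i] by auto
  have Wle: "measure M (W i) \<le> d / 2 * (1/2) ^ Suc i" for i
  proof -
    have "measure M (W i) \<le> measure M (F i \<inter> X - J -` C i \<inter> Y) + measure M ((X - F i) - J -` D i \<inter> Y)"
      unfolding W_def using C(3)[of i] D(3)[of i] by (intro measure_Un_le) auto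
    then show ?thesis using C(4)[of i] D(4)[of i] by simp
  qed
  define Z where "Z = (space M - X) \<union> (\<Union>i. W i)"
  have Z: "Z \<in> sets M" unfolding Z_def by measurable
  have "measure M Z < d"
  proof -
    have geo: "(\<lambda>i. d / 2 * (1/2) ^ Suc i) sums (d / 2 * 1)"
      by (intro sums_mult power_half_series)
    have summ: "summable (\<lambda>i. measure M (W i))"
      by (rule summable_comparison_test'[OF sums_summable[OF geo], of 0]) (use Wle in simp)
    have "measure M Z \<le> measure M (space M - X) + measure M (\<Union>i. W i)"
      unfolding Z_def by (intro measure_Un_le) auto
    also have "measure M (space M - X) = 0" using X by (simp add: full_measure_def measure_def)
    also have "measure M (\<Union>i. W i) \<le> (\<Sum>i. measure M (W i))"
      by (intro finite_measure_subadditive_countably) (auto simp: summ)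
    also have "\<dots> \<le> (\<Sum>i. d / 2 * (1/2) ^ Suc i)"
      by (intro suminf_le Wle summ sums_summable[OF geo])
    also have "\<dots> = d / 2" using sums_unique[OF geo] by simp
    finally show ?thesis using d by simp
  qed
  have inC: "J x \<in> C i" "x \<in> X" if "x \<in> F i" "x \<notin> Z" for x i
    using that sets.sets_into_space[OF F, of i] by (auto simp: Z_def W_def)
  have inD: "J x \<in> D i" "x \<in> X" if "x \<in> space M" "x \<notin> F i" "x \<notin> Z" for x i
    using that by (auto simp: Z_def W_def)
  \<comment> \<open>Avoiding a compact set is an open condition. Off \<open>Z\<close>, every
    \<open>J x\<close> lies in \<open>C (Suc i)\<close> or in \<open>D (Suc i)\<close>, so avoiding
    one means lying in the other, and \<open>(J x, J y) \<in> U i\<close> forces \<open>E i\<close>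
    to separate \<open>x\<close> and \<open>y\<close>.\<close>
  define U where "U i = (- D (Suc i)) \<times> (- C (Suc i)) \<union> (- C (Suc i)) \<times> (- D (Suc i))" for i
  have "compact (C 0 \<times> D 0)" by (intro compact_Times C D)
  moreover have "open (U i)" for i
    unfolding U_def using C(1) D(1) by (intro open_Un open_Times) (auto intro: compact_imp_closed)
  moreover have "C 0 \<times> D 0 \<subseteq> (\<Union>i. U i)"
  proof safe
    fix a b assume "a \<in> C 0" "b \<in> D 0"
    then have "a \<in> J ` (A \<inter> X \<inter> Y)" "b \<in> J ` ((X - A) \<inter> Y)"
      using C(2)[of 0] D(2)[of 0] by (auto simp: F_def)
    then obtain x y where x: "a = J x" "x \<in> A" "x \<in> X" "x \<in> Y" and y: "b = J y" "y \<notin> A" "y \<in> X" "y \<in> Y"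
      by blast
    then obtain i where i: "(x \<in> E i) \<noteq> (y \<in> E i)" using sep[of x y] by auto
    have *: "J z \<notin> D (Suc i)" if "z \<in> E i" "z \<in> Y" for z
      using D(2)[of "Suc i"] that inj by (auto simp: F_def inj_on_def)
    have **: "J z \<notin> C (Suc i)" if "z \<notin> E i" "z \<in> Y" for z
      using C(2)[of "Suc i"] that inj by (auto simp: F_def inj_on_def)
    show "(a, b) \<in> (\<Union>i. U i)"
      using i * ** x y by (auto simp: U_def intro!: exI[of _ i])
  qed
  ultimately obtain I where I: "finite I" "C 0 \<times> D 0 \<subseteq> (\<Union>i\<in>I. U i)"
    by (auto elim!: compactE_image[of _ UNIV U])
  show thesis
  proof (rule that[OF Z \<open>measure M Z < d\<close>])
    fix x y assume x: "x \<in> A - Z" and y: "y \<in> space M - A - Z"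
    have "x \<in> space M" using x sets.sets_into_space[OF A] by auto
    have "J x \<in> C 0" using inC[of x 0] x by (auto simp: F_def)
    moreover have "J y \<in> D 0" using inD[of y 0] y by (auto simp: F_def)
    ultimately obtain i where i: "i \<in> I" "(J x, J y) \<in> U i" using I(2) by blast
    have "(x \<in> E i) \<noteq> (y \<in> E i)"
      using i(2) inC[of x "Suc i"] inC[of y "Suc i"] inD[of x "Suc i"] inD[of y "Suc i"] x y \<open>x \<in> space M\<close>
      by (auto simp: U_def F_def)
    moreover have "i < Suc (Max I)" using I(1) i(1) by (auto simp: less_Suc_eq_le)
    ultimately show "\<exists>i<Suc (Max I). (x \<in> E i) \<noteq> (y \<in> E i)" by blast
  qed
qed

section \<open>Admissible semimetrics and iterates\<close>

lemma (in complete_measure) measurable_AE_eq: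
  assumes f: "f \<in> M \<rightarrow>\<^sub>M N" and eq: "AE x in M. f x = g x" and g: "g \<in> space M \<rightarrow> space N"
  shows "g \<in> M \<rightarrow>\<^sub>M N"
proof (rule measurableI)
  show "g x \<in> space N" if "x \<in> space M" for x using g that by auto
  fix A assume A: "A \<in> sets N"
  show "g -` A \<inter> space M \<in> sets M"
  proof (rule in_sets_AE[OF _ measurable_sets[OF f A]])
    show "AE x in M. (x \<in> f -` A \<inter> space M) \<longleftrightarrow> (x \<in> g -` A \<inter> space M)"
      using eq by eventually_elim auto
  qed auto
qed

lemma standard_prob_spaceD:
  assumes "standard_prob_space M"
  shows "prob_space M" "complete_measure M"
  using assms by (auto simp: standard_prob_space_def)

lemma semimetric_onD:
  assumes "semimetric_on X \<rho>" "x \<in> X" "y \<in> X"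
  shows "0 \<le> \<rho> x y" "\<rho> x y = \<rho> y x" "\<rho> x x = 0" "z \<in> X \<Longrightarrow> \<rho> x z \<le> \<rho> x y + \<rho> y z"
  using assms unfolding semimetric_on_def by blast+

text \<open>On the completed product, \<open>\<rho>\<close> agrees almost everywhere with a function
  \<open>g\<close> measurable for the product itself. By Fubini, almost every section of
  \<open>\<rho>\<close> agrees almost everywhere with a section of \<open>g\<close>, and
  completeness of \<open>M\<close> carries measurability over.\<close>

lemma AE_measurable_section:
  fixes \<rho> :: "'a \<Rightarrow> 'a \<Rightarrow> real"
  assumes "prob_space M" "complete_measure M"
    and \<rho>: "(\<lambda>(x, y). \<rho> x y) \<in> borel_measurable (completion (M \<Otimes>\<^sub>M M))"
  shows "AE x in M. \<rho> x \<in> borel_measurable M"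
proof -
  interpret prob_space M by fact
  interpret complete_measure M by fact
  interpret P: pair_sigma_finite M M ..
  obtain g where g [measurable]: "g \<in> borel_measurable (M \<Otimes>\<^sub>M M)"
    and eq: "AE z in M \<Otimes>\<^sub>M M. (case z of (x, y) \<Rightarrow> \<rho> x y) = g z"
    using completion_ex_borel_measurable_real[OF \<rho>] by blast
  from P.AE_pair[OF eq] AE_space show ?thesis
  proof eventually_elim
    case (elim x)
    show ?case
    proof (rule measurable_AE_eq[of "\<lambda>y. g (x, y)"])
      show "(\<lambda>y. g (x, y)) \<in> borel_measurable M" using elim(2) by measurable
      show "AE y in M. g (x, y) = \<rho> x y" using elim(1) by eventually_elim simp
    qed simp
  qed
qed

text \<open>By Fubini, almost every section has a finite integral. Through the triangle inequality,
  one such point \<open>x0\<close> bounds \<open>\<rho> x y\<close> by the sum of the integrable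
  one-variable terms \<open>\<rho> x0 x\<close> and \<open>\<rho> x0 y\<close>.\<close>

lemma summable_semimetric_integrable_section:
  assumes M: "prob_space M" "complete_measure M"
    and \<rho>: "measurable_semimetric M \<rho>" and summable: "summable_semimetric M \<rho>"
  obtains x0 where "x0 \<in> space M" "integrable M (\<rho> x0)"
proof -
  interpret prob_space M by fact
  interpret P: pair_sigma_finite M M ..
  have sm: "semimetric_on (space M) \<rho>"
    and meas: "(\<lambda>(x, y). \<rho> x y) \<in> borel_measurable (completion (M \<Otimes>\<^sub>M M))"
    using \<rho> by (auto simp: measurable_semimetric_def)
  have "(\<lambda>z. ennreal (case z of (x, y) \<Rightarrow> \<rho> x y)) \<in> borel_measurable (completion (M \<Otimes>\<^sub>M M))"
    using meas by measurable
  from completion_ex_borel_measurable[OF this]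
  obtain g where g [measurable]: "g \<in> borel_measurable (M \<Otimes>\<^sub>M M)"
    and eq: "AE z in M \<Otimes>\<^sub>M M. ennreal (case z of (x, y) \<Rightarrow> \<rho> x y) = g z" by blast
  have "(\<integral>\<^sup>+ x. \<integral>\<^sup>+ y. g (x, y) \<partial>M \<partial>M) = (\<integral>\<^sup>+ z. g z \<partial>(M \<Otimes>\<^sub>M M))"
    by (rule nn_integral_fst) measurable
  also have "\<dots> = (\<integral>\<^sup>+ z. ennreal (case z of (x, y) \<Rightarrow> \<rho> x y) \<partial>(M \<Otimes>\<^sub>M M))"
    by (rule nn_integral_cong_AE) (use eq in \<open>auto elim: AE_mp\<close>)
  also have "\<dots> = (\<integral>\<^sup>+ (x, y). ennreal (\<rho> x y) \<partial>completion (M \<Otimes>\<^sub>M M))"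
    by (simp add: nn_integral_completion case_prod_beta')
  also have "\<dots> < \<infinity>" using summable by (simp add: summable_semimetric_def)
  finally have "AE x in M. (\<integral>\<^sup>+ y. g (x, y) \<partial>M) \<noteq> \<infinity>"
    by (intro nn_integral_PInf_AE) auto
  with P.AE_pair[OF eq] AE_measurable_section[OF M meas] AE_space
  have "AE x in M. x \<in> space M \<and> integrable M (\<rho> x)"
  proof eventually_elim
    case (elim x)
    have "(\<integral>\<^sup>+ y. ennreal (\<rho> x y) \<partial>M) = (\<integral>\<^sup>+ y. g (x, y) \<partial>M)"
      by (rule nn_integral_cong_AE) (use elim(1) in \<open>eventually_elim, simp\<close>)
    with elim semimetric_onD(1)[OF sm] show ?case
      by (auto intro!: integrableI_nonneg simp: less_top)
  qed
  then obtain x where "x \<in> space M" "integrable M (\<rho> x)"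
    using eventually_happens[of _ "ae_filter M"] ae_filter_bot by blast
  then show thesis by (rule that)
qed

text \<open>A countable dense set of \<open>X\<close> may miss \<open>A\<close>. For each of its
  points and each radius \<open>1 / (n + 1)\<close>, a point of \<open>A\<close> is chosen in the
  ball whenever there is one; these choices are dense in \<open>A\<close>, at the price of doubling
  the radius.\<close>

lemma separable_semimetric_subset:
  assumes \<rho>: "semimetric_on X \<rho>" and sep: "separable_semimetric X \<rho>" and A: "A \<subseteq> X"
  shows "separable_semimetric A \<rho>"
proof -
  obtain D where D: "countable D" "D \<subseteq> X" "\<And>x e. x \<in> X \<Longrightarrow> e > 0 \<Longrightarrow> \<exists>d\<in>D. \<rho> x d < e"
    using sep unfolding separable_semimetric_def by blast
  define c where "c d n = (SOME a. a \<in> A \<and> \<rho> a d < 1 / real (Suc n))" for d n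
  define D' where "D' = {c d n | d n. d \<in> D \<and> (\<exists>a\<in>A. \<rho> a d < 1 / real (Suc n))}"
  have c: "c d n \<in> A \<and> \<rho> (c d n) d < 1 / real (Suc n)" if "\<exists>a\<in>A. \<rho> a d < 1 / real (Suc n)" for d n
    unfolding c_def by (rule someI_ex) (use that in blast)
  have "countable ((\<lambda>(d, n). c d n) ` (D \<times> UNIV))" using D(1) by simp
  then have "countable D'" by (rule countable_subset[rotated]) (auto simp: D'_def)
  moreover have "D' \<subseteq> A" using c by (auto simp: D'_def)
  moreover have "\<exists>a\<in>D'. \<rho> x a < e" if x: "x \<in> A" and e: "e > 0" for x e
  proof -
    obtain n where n: "1 / real (Suc n) < e / 2" using e nat_approx_posE[of "e/2"] by auto
    obtain d where d: "d \<in> D" "\<rho> x d < 1 / real (Suc n)" using D(3)[of x "1 / real (Suc n)"] x A by auto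
    then have ex: "\<exists>a\<in>A. \<rho> a d < 1 / real (Suc n)" using x by blast
    note cc = c[OF ex]
    have X: "x \<in> X" "d \<in> X" "c d n \<in> X" using x A d D(2) cc by auto
    have "\<rho> x (c d n) \<le> \<rho> x d + \<rho> d (c d n)" using semimetric_onD(4)[OF \<rho>] X by blast
    also have "\<rho> d (c d n) = \<rho> (c d n) d" using semimetric_onD(2)[OF \<rho>] X by blast
    finally have "\<rho> x (c d n) < e" using d(2) cc n by linarith
    then show ?thesis using d(1) ex by (auto simp: D'_def)
  qed
  ultimately show ?thesis unfolding separable_semimetric_def by blast
qed

text \<open>Only almost every section is known to be measurable, so the separable set is first cut
  down to the points with measurable sections. The functions \<open>\<rho> (s i)\<close> then serve
  as countably many measurable coordinates.\<close>

lemma admissible_dense_sequence: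
  assumes M: "prob_space M" "complete_measure M" and \<rho>: "admissible M \<rho>"
  obtains X and s :: "nat \<Rightarrow> 'a" where "full_measure M X" "range s \<subseteq> X"
    "\<And>i. \<rho> (s i) \<in> borel_measurable M" "\<And>x e. x \<in> X \<Longrightarrow> e > 0 \<Longrightarrow> \<exists>i. \<rho> (s i) x < e"
proof -
  interpret prob_space M by fact
  interpret complete_measure M by fact
  obtain X1 where X1: "full_measure M X1" "separable_semimetric X1 \<rho>"
    using \<rho> by (auto simp: admissible_def)
  have sm: "semimetric_on (space M) \<rho>"
    and meas: "(\<lambda>(x, y). \<rho> x y) \<in> borel_measurable (completion (M \<Otimes>\<^sub>M M))"
    using \<rho> by (auto simp: admissible_def measurable_semimetric_def)
  have X1': "X1 \<in> sets M" "AE x in M. x \<in> X1" using X1(1) by (auto simp: full_measure_iff_AE)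
  define X where "X = {x \<in> X1. \<rho> x \<in> borel_measurable M}"
  have "AE x in M. x \<in> X"
    using AE_measurable_section[OF M meas] X1'(2) by eventually_elim (auto simp: X_def)
  have "X \<in> sets M"
  proof (rule in_sets_AE[OF _ X1'(1)])
    show "AE x in M. (x \<in> X1) = (x \<in> X)"
      using \<open>AE x in M. x \<in> X\<close> X1'(2) by eventually_elim simp
    show "X \<subseteq> space M" using sets.sets_into_space[OF X1'(1)] by (auto simp: X_def)
  qed
  with \<open>AE x in M. x \<in> X\<close> have full: "full_measure M X" by (simp add: full_measure_iff_AE)
  have X: "X \<subseteq> space M" using sets.sets_into_space[OF \<open>X \<in> sets M\<close>] .
  have sm1: "semimetric_on X1 \<rho>"
    using sm sets.sets_into_space[OF X1'(1)] unfolding semimetric_on_def by blast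
  have "separable_semimetric X \<rho>"
    by (rule separable_semimetric_subset[OF sm1 X1(2)]) (auto simp: X_def)
  then obtain D where D: "countable D" "D \<subseteq> X" "\<And>x e. x \<in> X \<Longrightarrow> e > 0 \<Longrightarrow> \<exists>d\<in>D. \<rho> x d < e"
    unfolding separable_semimetric_def by blast
  obtain x where "x \<in> X"
    using eventually_happens[OF \<open>AE x in M. x \<in> X\<close>] ae_filter_bot by blast
  with D(3)[of x 1] have "D \<noteq> {}" by auto
  show thesis
  proof (rule that[OF full])
    show "range (from_nat_into D) \<subseteq> X" using from_nat_into[OF \<open>D \<noteq> {}\<close>] D(2) by blast
    then show "\<rho> (from_nat_into D i) \<in> borel_measurable M" for i by (auto simp: X_def)
    fix x and e :: real assume x: "x \<in> X" and "e > 0"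
    then obtain d where d: "d \<in> D" "\<rho> x d < e" using D(3) by blast
    obtain i where i: "from_nat_into D i = d" using from_nat_into_surj[OF D(1) d(1)] by blast
    have "\<rho> d x = \<rho> x d" using semimetric_onD(2)[OF sm] x d(1) D(2) X by blast
    then show "\<exists>i. \<rho> (from_nat_into D i) x < e" using i d(2) by (intro exI[of _ i]) simp
  qed
qed

section \<open>Measure-preserving maps and integer iterates\<close>

lemma measure_preserving_map_id: "measure_preserving_map M (\<lambda>x. x)"
  by (simp add: measure_preserving_map_def distr_id2)

lemma measure_preserving_map_comp:
  assumes "measure_preserving_map M f" "measure_preserving_map M g"
  shows "measure_preserving_map M (f \<circ> g)"
  using assms distr_distr[of f M M g M] by (auto simp: measure_preserving_map_def)

lemma measure_preserving_map_funpow: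
  assumes "measure_preserving_map M f"
  shows "measure_preserving_map M (f ^^ n)"
proof (induction n)
  case 0
  then show ?case using measure_preserving_map_id[of M] by (simp add: id_def)
next
  case (Suc n)
  then show ?case using measure_preserving_map_comp[OF assms] by (simp add: o_def)
qed

lemma measure_preserving_map_AE:
  assumes f: "measure_preserving_map M f" and P: "AE x in M. P x"
  shows "AE x in M. P (f x)"
proof -
  have m: "f \<in> M \<rightarrow>\<^sub>M M" "distr M M f = M" using f by (auto simp: measure_preserving_map_def)
  have "AE x in distr M M f. P x" unfolding m(2) by (rule P)
  then show ?thesis by (rule AE_distrD[OF m(1)])
qed

lemma inverse_mod0_inv_mod0:
  assumes "automorphism_mod0 M T"
  shows "inverse_mod0 M T (inv_mod0 M T)"
  using assms unfolding automorphism_mod0_def inv_mod0_def by (metis someI_ex)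

text \<open>The image of the measure under the inverse equals its image under the inverse composed
  with \<open>T\<close>, as \<open>T\<close> preserves the measure, and that composition is almost
  everywhere the identity.\<close>

lemma measure_preserving_inv_mod0:
  assumes "automorphism_mod0 M T"
  shows "measure_preserving_map M (inv_mod0 M T)"
proof -
  let ?S = "inv_mod0 M T"
  have S: "?S \<in> M \<rightarrow>\<^sub>M M" "AE x in M. ?S (T x) = x"
    using inverse_mod0_inv_mod0[OF assms] by (auto simp: inverse_mod0_def)
  have T: "T \<in> M \<rightarrow>\<^sub>M M" "distr M M T = M"
    using assms by (auto simp: automorphism_mod0_def measure_preserving_map_def)
  have "distr M M ?S = distr (distr M M T) M ?S" using T by simp
  also have "\<dots> = distr M M (?S \<circ> T)" by (rule distr_distr) fact+
  also have "\<dots> = distr M M (\<lambda>x. x)"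
    by (rule distr_cong_AE) (use S T in auto)
  also have "\<dots> = M" by (simp add: distr_id2)
  finally show ?thesis using S by (simp add: measure_preserving_map_def)
qed

lemma measure_preserving_int_iterate:
  assumes "automorphism_mod0 M T"
  shows "measure_preserving_map M (int_iterate M T k)"
  using assms measure_preserving_inv_mod0[OF assms]
  by (auto simp: int_iterate_def automorphism_mod0_def intro!: measure_preserving_map_funpow)

text \<open>The chosen inverse cancels \<open>T\<close> only off a null set, which is pulled back
  along the forward iterates. Starting from time \<open>n\<close>, iterates with
  \<open>k \<ge> - n\<close> thus become ordinary forward iterates, the only ones that occur in the
  averages.\<close>

lemma AE_int_iterate_funpow:
  assumes T: "automorphism_mod0 M T" and k: "k + int n \<ge> 0"
  shows "AE x in M. int_iterate M T k ((T ^^ n) x) = (T ^^ nat (k + int n)) x"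
proof (cases "k \<ge> 0")
  case True
  then have "nat (k + int n) = nat k + n" by simp
  then show ?thesis using True by (simp add: int_iterate_def funpow_add)
next
  case False
  let ?S = "inv_mod0 M T"
  have S: "AE x in M. ?S (T x) = x"
    using inverse_mod0_inv_mod0[OF T] by (auto simp: inverse_mod0_def)
  have mpT: "measure_preserving_map M T" using T by (simp add: automorphism_mod0_def)
  have "AE x in M. (?S ^^ m) ((T ^^ n) x) = (T ^^ (n - m)) x" if "m \<le> n" for m
    using that
  proof (induction m)
    case (Suc m)
    have "n - m = Suc (n - Suc m)" using Suc.prems by simp
    then have *: "(T ^^ (n - m)) x = T ((T ^^ (n - Suc m)) x)" for x by simp
    have "AE x in M. ?S (T ((T ^^ (n - Suc m)) x)) = (T ^^ (n - Suc m)) x"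
      by (rule measure_preserving_map_AE[OF measure_preserving_map_funpow[OF mpT] S])
    moreover have "AE x in M. (?S ^^ m) ((T ^^ n) x) = (T ^^ (n - m)) x" using Suc by simp
    ultimately show ?case by eventually_elim (simp add: *)
  qed simp
  from this[of "nat (- k)"] k False have "AE x in M. (?S ^^ nat (- k)) ((T ^^ n) x) = (T ^^ (n - nat (- k))) x"
    by simp
  moreover have "n - nat (- k) = nat (k + int n)" using k False by linarith
  ultimately show ?thesis using False by (simp add: int_iterate_def)
qed

section \<open>Domination by a generating semimetric\<close>

text \<open>The strips shrink to the empty set as \<open>\<eta>\<close> tends to 0. Once such a
  strip is removed, two values on different sides of the threshold \<open>q\<close> differ by at
  least \<open>\<eta>\<close>.\<close>

lemma (in finite_measure) small_strip_below:
  fixes \<phi> :: "'a \<Rightarrow> real"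
  assumes [measurable]: "\<phi> \<in> borel_measurable M" and d: "d > 0"
  shows "\<exists>\<eta>>0. measure M {y \<in> space M. q - \<eta> \<le> \<phi> y \<and> \<phi> y < q} < d"
proof -
  define S where "S n = {y \<in> space M. q - 1 / real (Suc n) \<le> \<phi> y \<and> \<phi> y < q}" for n
  have [measurable]: "S n \<in> sets M" for n unfolding S_def by measurable
  have "(\<lambda>n. measure M (S n)) \<longlonglongrightarrow> measure M (\<Inter>n. S n)"
  proof (rule finite_Lim_measure_decseq)
    show "decseq S"
      unfolding decseq_Suc_iff
    proof
      fix n
      have "1 / real (Suc (Suc n)) \<le> 1 / real (Suc n)" by (simp add: field_simps)
      then show "S (Suc n) \<subseteq> S n" by (auto simp: S_def)
    qed
  qed auto
  moreover have "(\<Inter>n. S n) = {}"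
  proof (rule ccontr)
    assume "(\<Inter>n. S n) \<noteq> {}"
    then obtain y where y: "\<And>n. y \<in> S n" by blast
    then have "q - \<phi> y > 0" by (auto simp: S_def)
    then obtain n where "1 / real (Suc n) < q - \<phi> y" using nat_approx_posE by blast
    with y[of n] show False by (auto simp: S_def)
  qed
  ultimately have "(\<lambda>n. measure M (S n)) \<longlonglongrightarrow> 0" by simp
  then have "\<forall>\<^sub>F n in sequentially. measure M (S n) < d"
    using d by (intro order_tendstoD(2)) auto
  then obtain n where n: "measure M (S n) < d"
    by (auto simp: eventually_sequentially)
  then show ?thesis unfolding S_def by (intro exI[of _ "1 / real (Suc n)"]) auto
qed

text \<open>The sets where \<open>\<rho> (s i)\<close>, evaluated at the iterate number
  \<open>k\<close>, is below a rational \<open>q\<close> separate the points of a set of full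
  measure. Finitely many of them separate \<open>A\<close> from its complement off a small set.
  Removing thin strips below the thresholds makes this quantitative, and since
  \<open>\<rho> (s i)\<close> is 1-Lipschitz, the gap passes to the distance of the
  iterates.\<close>

lemma generating_positive_separation:
  assumes std: "standard_prob_space M" and T: "automorphism_mod0 M T"
    and \<rho>: "admissible M \<rho>" and gen: "generating M T \<rho>"
    and A: "A \<in> sets M" and d: "d > 0"
  obtains Z K \<eta> where "Z \<in> sets M" "measure M Z < d" "\<eta> > 0"
    "\<And>x y. x \<in> A - Z \<Longrightarrow> y \<in> space M - A - Z \<Longrightarrow>
       \<exists>k\<in>{- int K..int K}. \<eta> \<le> \<rho> (int_iterate M T k x) (int_iterate M T k y)"
proof -
  note M = standard_prob_spaceD[OF std]
  interpret prob_space M by (rule M)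
  obtain X and s :: "nat \<Rightarrow> 'a" where X: "full_measure M X" "range s \<subseteq> X"
    and s: "\<And>i. \<rho> (s i) \<in> borel_measurable M" "\<And>x e. x \<in> X \<Longrightarrow> e > 0 \<Longrightarrow> \<exists>i. \<rho> (s i) x < e"
    using admissible_dense_sequence[OF M \<rho>] by blast
  obtain X' where X': "full_measure M X'"
    and sep: "\<And>x y. x \<in> X' \<Longrightarrow> y \<in> X' \<Longrightarrow> x \<noteq> y \<Longrightarrow> \<exists>k::int. \<rho> (int_iterate M T k x) (int_iterate M T k y) > 0"
    using gen unfolding generating_def shift_semimetric_def by blast
  have sm: "semimetric_on (space M) \<rho>" using \<rho> by (simp add: admissible_def measurable_semimetric_def)
  have [measurable]: "X \<in> sets M" "X' \<in> sets M" using X X' by (auto simp: full_measure_def)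
  have Xsp: "X \<subseteq> space M" using sets.sets_into_space \<open>X \<in> sets M\<close> .
  then have ssp: "s i \<in> space M" for i using X(2) by auto
  define U where "U = int_iterate M T"
  have mp: "measure_preserving_map M (U k)" for k
    unfolding U_def by (rule measure_preserving_int_iterate[OF T])
  then have Um: "U k \<in> M \<rightarrow>\<^sub>M M" for k by (simp add: measure_preserving_map_def)
  have Usp: "U k x \<in> space M" if "x \<in> space M" for k x using measurable_space[OF Um that] .
  \<comment> \<open>Every iterate of a point of \<open>W\<close> lies in \<open>X\<close>, so the
    dense sequence approximates it at every time.\<close>
  define W where "W = {x \<in> X'. \<forall>k. U k x \<in> X}"
  have full: "full_measure M W"
    unfolding full_measure_iff_AE
  proof
    have "W = X' \<inter> (\<Inter>k. U k -` X \<inter> space M)"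
      using sets.sets_into_space[OF \<open>X' \<in> sets M\<close>] by (auto simp: W_def)
    also have "\<dots> \<in> sets M"
      using measurable_sets[OF Um \<open>X \<in> sets M\<close>]
      by (intro sets.Int \<open>X' \<in> sets M\<close> sets.countable_INT') auto
    finally show "W \<in> sets M" .
    have "AE x in M. \<forall>k. U k x \<in> X"
      unfolding AE_all_countable
    proof
      fix k
      have "AE x in M. x \<in> X" using X(1) by (simp add: full_measure_iff_AE)
      then show "AE x in M. U k x \<in> X" by (rule measure_preserving_map_AE[OF mp])
    qed
    moreover have "AE x in M. x \<in> X'" using X' by (simp add: full_measure_iff_AE)
    ultimately show "AE x in M. x \<in> W" by eventually_elim (simp add: W_def)
  qed
  \<comment> \<open>One natural number codes a triple of time, centre and threshold, so that the
    separating sets form a sequence.\<close>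
  define \<phi> where "\<phi> n = (case from_nat n of (k, i, q::rat) \<Rightarrow> (\<lambda>y. \<rho> (s i) (U k y)))" for n
  define q where "q n = (case from_nat n of (k::int, i::nat, q) \<Rightarrow> real_of_rat q)" for n
  define E where "E n = {y \<in> space M. \<phi> n y < q n}" for n
  have \<phi> [measurable]: "\<phi> n \<in> borel_measurable M" for n
    using measurable_compose[OF Um s(1)] by (auto simp: \<phi>_def split: prod.split)
  have E [measurable]: "E n \<in> sets M" for n unfolding E_def by measurable
  have Esep: "\<exists>n. (x \<in> E n) \<noteq> (y \<in> E n)" if xy: "x \<in> W" "y \<in> W" "x \<noteq> y" for x y
  proof -
    obtain k where k: "\<rho> (U k x) (U k y) > 0"
      using sep[of x y] xy by (auto simp: W_def U_def)
    let ?r = "\<rho> (U k x) (U k y)"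
    have UX: "U k x \<in> X" "U k y \<in> X" using xy by (auto simp: W_def)
    \<comment> \<open>A centre within \<open>?r / 3\<close> of one point is further than
      \<open>2 * ?r / 3\<close> from the other, which leaves room for a rational threshold between
      the two distances.\<close>
    obtain i where i: "\<rho> (s i) (U k x) < ?r / 3" using s(2)[OF UX(1), of "?r / 3"] k by auto
    have sp: "s i \<in> space M" "U k x \<in> space M" "U k y \<in> space M" using ssp UX Xsp by auto
    have "?r \<le> \<rho> (U k x) (s i) + \<rho> (s i) (U k y)" "\<rho> (U k x) (s i) = \<rho> (s i) (U k x)"
      using semimetric_onD(4)[OF sm sp(2,1,3)] semimetric_onD(2)[OF sm sp(2,1)] by this+
    then have "\<rho> (s i) (U k x) < \<rho> (s i) (U k y)" using i k by linarith
    then obtain t where t: "\<rho> (s i) (U k x) < real_of_rat t" "real_of_rat t < \<rho> (s i) (U k y)"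
      using of_rat_dense by blast
    let ?n = "to_nat (k, i, t)"
    have "x \<in> E ?n" "y \<notin> E ?n"
      using t xy sets.sets_into_space[OF \<open>X' \<in> sets M\<close>] by (auto simp: E_def \<phi>_def q_def W_def)
    then show ?thesis by blast
  qed
  obtain Z N where Z: "Z \<in> sets M" "measure M Z < d / 2"
    and ZN: "\<And>x y. x \<in> A - Z \<Longrightarrow> y \<in> space M - A - Z \<Longrightarrow> \<exists>n<N::nat. (x \<in> E n) \<noteq> (y \<in> E n)"
    using separating_sequence_finite_subfamily[OF std E full Esep A, of "d / 2"] d by auto
  have "\<exists>\<eta>>0. measure M {y \<in> space M. q n - \<eta> \<le> \<phi> n y \<and> \<phi> n y < q n} < d / 2 / real (Suc N)" for n
    by (rule small_strip_below) (use d in auto)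
  then obtain \<eta> where \<eta>: "\<And>n. \<eta> n > 0"
    and strip: "\<And>n. measure M {y \<in> space M. q n - \<eta> n \<le> \<phi> n y \<and> \<phi> n y < q n} < d / 2 / real (Suc N)"
    by metis
  define S where "S n = {y \<in> space M. q n - \<eta> n \<le> \<phi> n y \<and> \<phi> n y < q n}" for n
  have S [measurable]: "S n \<in> sets M" for n unfolding S_def by measurable
  define Z' where "Z' = Z \<union> (\<Union>n<N. S n)"
  define \<eta>0 where "\<eta>0 = Min (insert 1 (\<eta> ` {..<N}))"
  have \<eta>0: "\<eta>0 > 0" "\<And>n. n < N \<Longrightarrow> \<eta>0 \<le> \<eta> n"
    using \<eta> by (auto simp: \<eta>0_def)
  define kk where "kk n = (case from_nat n of (k::int, i::nat, q::rat) \<Rightarrow> k)" for n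
  define K where "K = Max (insert 0 ((\<lambda>n. nat \<bar>kk n\<bar>) ` {..<N}))"
  have K: "kk n \<in> {- int K..int K}" if "n < N" for n
  proof -
    have "nat \<bar>kk n\<bar> \<le> K" unfolding K_def using that by (intro Max_ge) auto
    then show ?thesis by auto
  qed
  show thesis
  proof (rule that[of Z' \<eta>0 K])
    show "Z' \<in> sets M" unfolding Z'_def using Z by auto
    have "measure M (\<Union>n<N. S n) \<le> (\<Sum>n<N. measure M (S n))"
      by (intro measure_UNION_le) auto
    also have "\<dots> \<le> (\<Sum>n<N. d / 2 / real (Suc N))"
      using strip by (intro sum_mono less_imp_le) (simp add: S_def)
    also have "\<dots> \<le> d / 2" using d by (simp add: field_simps)
    finally have "measure M (\<Union>n<N. S n) \<le> d / 2" .
    moreover have "measure M Z' \<le> measure M Z + measure M (\<Union>n<N. S n)"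
      unfolding Z'_def using Z by (intro measure_Un_le) auto
    ultimately show "measure M Z' < d" using Z(2) by simp
    show "\<eta>0 > 0" by fact
    fix x y assume x: "x \<in> A - Z'" and y: "y \<in> space M - A - Z'"
    have xsp: "x \<in> space M" "y \<in> space M" using x y sets.sets_into_space[OF A] by auto
    obtain n where n: "n < N" "(x \<in> E n) \<noteq> (y \<in> E n)"
      using ZN[of x y] x y by (auto simp: Z'_def)
    obtain k i t where kit: "from_nat n = (k::int, i::nat, t::rat)" by (metis prod_cases3)
    have \<phi>n: "\<phi> n z = \<rho> (s i) (U k z)" and kn: "kk n = k" for z
      using kit by (auto simp: \<phi>_def kk_def)
    have notS: "x \<notin> S n" "y \<notin> S n" using x y n(1) by (auto simp: Z'_def)
    \<comment> \<open>One value is at least \<open>q n\<close>; the other is below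
      \<open>q n\<close> and outside the strip, hence below \<open>q n - \<eta> n\<close>.\<close>
    have "\<eta> n \<le> \<bar>\<phi> n x - \<phi> n y\<bar>"
      using n(2) notS xsp by (auto simp: E_def S_def)
    moreover have "\<bar>\<rho> (s i) (U k x) - \<rho> (s i) (U k y)\<bar> \<le> \<rho> (U k x) (U k y)"
    proof -
      have sp: "s i \<in> space M" "U k x \<in> space M" "U k y \<in> space M" using ssp Usp xsp by auto
      have "\<rho> (s i) (U k x) \<le> \<rho> (s i) (U k y) + \<rho> (U k y) (U k x)"
        "\<rho> (s i) (U k y) \<le> \<rho> (s i) (U k x) + \<rho> (U k x) (U k y)"
        "\<rho> (U k y) (U k x) = \<rho> (U k x) (U k y)"
        using semimetric_onD(4)[OF sm sp(1,3,2)] semimetric_onD(4)[OF sm sp(1,2,3)]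
          semimetric_onD(2)[OF sm sp(3,2)] by this+
      then show ?thesis by linarith
    qed
    ultimately have "\<eta>0 \<le> \<rho> (U k x) (U k y)" using \<eta>0(2)[OF n(1)] by (simp add: \<phi>n)
    then show "\<exists>k\<in>{- int K..int K}. \<eta>0 \<le> \<rho> (int_iterate M T k x) (int_iterate M T k y)"
      using K[OF n(1)] by (auto simp: kn U_def)
  qed
qed

lemma integrable_tail_small:
  fixes f :: "'a \<Rightarrow> real"
  assumes f: "integrable M f" and pos: "\<And>x. x \<in> space M \<Longrightarrow> 0 \<le> f x" and e: "e > 0"
  shows "\<exists>R>0. (\<integral>x. f x * indicator {x \<in> space M. R < f x} x \<partial>M) < e"
proof -
  have [measurable]: "f \<in> borel_measurable M" using f by auto
  have "(\<lambda>n. \<integral>x. f x * indicator {x \<in> space M. real n < f x} x \<partial>M) \<longlonglongrightarrow> (\<integral>x. 0 \<partial>M)"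
  proof (rule integral_dominated_convergence[where w = "\<lambda>x. f x"])
    show "AE x in M. (\<lambda>n. f x * indicator {x \<in> space M. real n < f x} x) \<longlonglongrightarrow> 0"
    proof (rule AE_I2)
      fix x assume "x \<in> space M"
      obtain m where m: "f x \<le> real m" using real_arch_simple by blast
      have "f x * indicator {x \<in> space M. real n < f x} x = 0" if "n \<ge> m" for n
        using that m by (auto simp: indicator_def)
      then show "(\<lambda>n. f x * indicator {x \<in> space M. real n < f x} x) \<longlonglongrightarrow> 0"
        by (intro tendsto_eventually) (auto simp: eventually_sequentially)
    qed
    show "AE x in M. norm (f x * indicator {x \<in> space M. real n < f x} x) \<le> f x" for n
      by (rule AE_I2) (use pos in \<open>auto simp: indicator_def\<close>)
  qed (use f in auto)
  then have "\<forall>\<^sub>F n in sequentially. (\<integral>x. f x * indicator {x \<in> space M. real n < f x} x \<partial>M) < e"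
    using e by (intro order_tendstoD(2)) auto
  then obtain n where "\<And>m. m \<ge> n \<Longrightarrow> (\<integral>x. f x * indicator {x \<in> space M. real m < f x} x \<partial>M) < e"
    by (auto simp: eventually_sequentially)
  from this[of "Suc n"] show ?thesis by (intro exI[of _ "real (Suc n)"]) auto
qed

lemma (in finite_measure) measure_minus_finite_UN_small:
  fixes B :: "nat \<Rightarrow> 'a set"
  assumes B [measurable]: "\<And>i. B i \<in> sets M" and cover: "AE x in M. \<exists>i. x \<in> B i" and d: "d > 0"
  shows "\<exists>N. measure M (space M - (\<Union>i<N. B i)) < d"
proof -
  let ?S = "\<lambda>n. space M - (\<Union>i<n. B i)"
  have "(\<lambda>n. measure M (?S n)) \<longlonglongrightarrow> measure M (\<Inter>n. ?S n)"
    by (rule finite_Lim_measure_decseq) (auto simp: decseq_def)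
  moreover have "measure M (\<Inter>n. ?S n) = 0"
  proof -
    have "AE x in M. x \<notin> (\<Inter>n. ?S n)"
      using cover by eventually_elim (auto intro: lessI)
    moreover have "(\<Inter>n. ?S n) \<in> sets M" by (intro sets.countable_INT') auto
    ultimately show ?thesis by (intro measure_eq_0_null_sets) (simp add: AE_iff_null_sets)
  qed
  ultimately have "\<forall>\<^sub>F n in sequentially. measure M (?S n) < d"
    using d by (intro order_tendstoD(2)) auto
  then show ?thesis by (auto simp: eventually_sequentially)
qed

text \<open>A bad set \<open>W\<close> collects the points far from \<open>x0\<close>, those outside
  the chosen balls, and those where separation fails. If one of the two points is bad,
  \<open>g\<close> pays for the distance. If both are good and share a ball, the distance is at most
  \<open>e\<close>. Otherwise the sum over \<open>k\<close> is at least \<open>\<eta>0\<close>, and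
  the factor \<open>C\<close> lifts it above \<open>2 * R\<close>, which bounds the distance of two
  good points.\<close>

lemma lipschitz_up_to_small_error:
  assumes std: "standard_prob_space M" and T: "automorphism_mod0 M T"
    and \<rho>: "admissible M \<rho>" and gen: "generating M T \<rho>"
    and \<rho>': "admissible M \<rho>'" and summable: "summable_semimetric M \<rho>'" and e: "e > 0"
  obtains K C g where "C \<ge> 0" "integrable M g" "\<And>x. x \<in> space M \<Longrightarrow> 0 \<le> g x" "(\<integral>x. g x \<partial>M) \<le> e"
    "\<And>x y. x \<in> space M \<Longrightarrow> y \<in> space M \<Longrightarrow>
       \<rho>' x y \<le> C * (\<Sum>k\<in>{- int K..int K}. \<rho> (int_iterate M T k x) (int_iterate M T k y)) + g x + g y + e"
proof -
  note M = standard_prob_spaceD[OF std]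
  interpret prob_space M by (rule M)
  define U where "U = int_iterate M T"
  have Usp: "U k x \<in> space M" if "x \<in> space M" for k x
    using measure_preserving_int_iterate[OF T, of k] measurable_space[of "U k" M M x] that
    by (auto simp: U_def measure_preserving_map_def)
  have sm: "semimetric_on (space M) \<rho>" and sm': "semimetric_on (space M) \<rho>'"
    using \<rho> \<rho>' by (auto simp: admissible_def measurable_semimetric_def)
  obtain X and s :: "nat \<Rightarrow> 'a" where X: "full_measure M X" "range s \<subseteq> X"
    and s [measurable]: "\<And>i. \<rho>' (s i) \<in> borel_measurable M"
    and dense: "\<And>x e. x \<in> X \<Longrightarrow> e > 0 \<Longrightarrow> \<exists>i. \<rho>' (s i) x < e"
    using admissible_dense_sequence[OF M \<rho>'] by blast
  have "X \<subseteq> space M" using X(1) sets.sets_into_space by (auto simp: full_measure_def)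
  then have ssp: "s i \<in> space M" for i using X(2) by auto
  obtain x0 where x0: "x0 \<in> space M" and f: "integrable M (\<rho>' x0)"
    using summable_semimetric_integrable_section[OF M _ summable] \<rho>' by (auto simp: admissible_def)
  have [measurable]: "\<rho>' x0 \<in> borel_measurable M" using f by auto
  have f0: "0 \<le> \<rho>' x0 x" if "x \<in> space M" for x using semimetric_onD(1)[OF sm' x0 that] .
  have ff: "\<rho>' x y \<le> \<rho>' x0 x + \<rho>' x0 y" if "x \<in> space M" "y \<in> space M" for x y
    using semimetric_onD(4)[OF sm' that(1) x0 that(2)] semimetric_onD(2)[OF sm' that(1) x0] by simp
  obtain R where R: "R > 0" and tail: "(\<integral>x. \<rho>' x0 x * indicator {x \<in> space M. R < \<rho>' x0 x} x \<partial>M) < e / 4"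
    using integrable_tail_small[OF f f0, of "e / 4"] e by auto
  \<comment> \<open>With this value, a set of measure at most \<open>2 * d\<close> on which
    \<open>g\<close> is at most \<open>2 * R\<close> contributes at most \<open>e / 2\<close> to the
    integral of \<open>g\<close>.\<close>
  define d where "d = e / (8 * R)"
  have d: "d > 0" using e R by (simp add: d_def)
  define B where "B i = {y \<in> space M. \<rho>' (s i) y < e / 2}" for i
  have B [measurable]: "B i \<in> sets M" for i unfolding B_def by measurable
  have "AE x in M. x \<in> X" using X(1) by (simp add: full_measure_iff_AE)
  then have "AE x in M. \<exists>i. x \<in> B i"
    using AE_space
  proof eventually_elim
    case (elim x)
    then show ?case using dense[of x "e / 2"] e by (simp add: B_def)
  qed
  from measure_minus_finite_UN_small[OF B this d]
  obtain N where N: "measure M (space M - (\<Union>i<N. B i)) < d" by blast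
  have "d / real (Suc N) > 0" using d by simp
  then have "\<exists>Z K \<eta>. Z \<in> sets M \<and> measure M Z < d / real (Suc N) \<and> \<eta> > 0 \<and> (\<forall>x\<in>B i - Z. \<forall>y\<in>space M - B i - Z.
       \<exists>k\<in>{- int K..int K}. \<eta> \<le> \<rho> (U k x) (U k y))" for i
    unfolding U_def by (rule generating_positive_separation[OF std T \<rho> gen B]) blast
  then obtain Z K \<eta> where Z [measurable]: "\<And>i. Z i \<in> sets M" and Zd: "\<And>i. measure M (Z i) < d / real (Suc N)"
    and \<eta>: "\<And>i. \<eta> i > 0"
    and sep: "\<And>i x y. x \<in> B i - Z i \<Longrightarrow> y \<in> space M - B i - Z i \<Longrightarrow> \<exists>k\<in>{- int (K i)..int (K i)}. \<eta> i \<le> \<rho> (U k x) (U k y)"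
    by metis
  define \<eta>0 where "\<eta>0 = Min (insert 1 (\<eta> ` {..<N}))"
  have \<eta>0: "\<eta>0 > 0" "\<And>n. n < N \<Longrightarrow> \<eta>0 \<le> \<eta> n"
    using \<eta> by (auto simp: \<eta>0_def)
  define K0 where "K0 = Max (insert 0 (K ` {..<N}))"
  have K0: "K i \<le> K0" if "i < N" for i unfolding K0_def using that by (intro Max_ge) auto
  define Z1 where "Z1 = (space M - (\<Union>i<N. B i)) \<union> (\<Union>i<N. Z i)"
  have Z1 [measurable]: "Z1 \<in> sets M" unfolding Z1_def by measurable
  have Z1d: "measure M Z1 \<le> 2 * d"
  proof -
    have "measure M (\<Union>i<N. Z i) \<le> (\<Sum>i<N. measure M (Z i))"
      by (intro measure_UNION_le) auto
    also have "\<dots> \<le> (\<Sum>i<N. d / real (Suc N))"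
      using Zd by (intro sum_mono less_imp_le)
    also have "\<dots> \<le> d" using d by (simp add: field_simps)
    finally have "measure M (\<Union>i<N. Z i) \<le> d" .
    moreover have "measure M Z1 \<le> measure M (space M - (\<Union>i<N. B i)) + measure M (\<Union>i<N. Z i)"
      unfolding Z1_def by (intro measure_Un_le) auto
    ultimately show ?thesis using N by simp
  qed
  define W where "W = {x \<in> space M. R < \<rho>' x0 x} \<union> Z1"
  have W [measurable]: "W \<in> sets M" unfolding W_def by measurable
  define g where "g x = (\<rho>' x0 x + R) * indicator W x" for x
  define C where "C = 2 * R / \<eta>0"
  have C: "C \<ge> 0" using R \<eta>0(1) by (simp add: C_def)
  have gint: "integrable M g"
    unfolding g_def using f by (intro integrable_real_mult_indicator) auto
  have g0: "0 \<le> g x" if "x \<in> space M" for x using f0[OF that] R by (auto simp: g_def indicator_def)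
  have i1: "integrable M (\<lambda>x. 2 * (\<rho>' x0 x * indicator {x \<in> space M. R < \<rho>' x0 x} x))"
    by (intro integrable_mult_right integrable_real_mult_indicator f) measurable
  have i2: "integrable M (\<lambda>x. 2 * R * indicator Z1 x)"
    by (intro integrable_mult_right integrable_real_indicator) (auto simp: emeasure_eq_measure)
  \<comment> \<open>Where \<open>\<rho>' x0 x\<close> exceeds \<open>R\<close>, it absorbs the
    summand \<open>R\<close> of \<open>g\<close>; on the rest of \<open>W\<close> both summands are
    at most \<open>R\<close>.\<close>
  have "(\<integral>x. g x \<partial>M) \<le> (\<integral>x. 2 * (\<rho>' x0 x * indicator {x \<in> space M. R < \<rho>' x0 x} x) + 2 * R * indicator Z1 x \<partial>M)"
  proof (rule integral_mono[OF gint])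
    show "integrable M (\<lambda>x. 2 * (\<rho>' x0 x * indicator {x \<in> space M. R < \<rho>' x0 x} x) + 2 * R * indicator Z1 x)"
      by (rule Bochner_Integration.integrable_add[OF i1 i2])
    show "g x \<le> 2 * (\<rho>' x0 x * indicator {x \<in> space M. R < \<rho>' x0 x} x) + 2 * R * indicator Z1 x" if "x \<in> space M" for x
      using f0[OF that] R that by (auto simp: g_def W_def indicator_def)
  qed
  also have "\<dots> = 2 * (\<integral>x. \<rho>' x0 x * indicator {x \<in> space M. R < \<rho>' x0 x} x \<partial>M) + 2 * R * measure M Z1"
    by (subst Bochner_Integration.integral_add[OF i1 i2]) simp
  also have "\<dots> \<le> 2 * (e / 4) + 2 * R * (2 * d)"
    using tail Z1d R by (intro add_mono mult_left_mono) auto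
  also have "\<dots> = e" using R by (simp add: d_def)
  finally have gle: "(\<integral>x. g x \<partial>M) \<le> e" .
  show thesis
  proof (rule that[OF C gint g0 gle])
    fix x y assume xy: "x \<in> space M" "y \<in> space M"
    let ?S = "\<Sum>k\<in>{- int K0..int K0}. \<rho> (int_iterate M T k x) (int_iterate M T k y)"
    have pos: "0 \<le> \<rho> (U k x) (U k y)" for k using semimetric_onD(1)[OF sm Usp[OF xy(1)] Usp[OF xy(2)]] .
    then have S0: "0 \<le> C * ?S" using C unfolding U_def by (intro mult_nonneg_nonneg sum_nonneg) auto
    show "\<rho>' x y \<le> C * ?S + g x + g y + e"
    proof (cases "x \<in> W \<or> y \<in> W")
      case True
      have inW: "\<rho>' x0 z + R = g z" if "z \<in> W" for z using that by (simp add: g_def)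
      \<comment> \<open>The extra \<open>R\<close> in \<open>g\<close> at the bad point covers the
        distance from \<open>x0\<close> to the other point when that one is good.\<close>
      have le: "\<rho>' x0 z \<le> g z + R" if "z \<in> space M" for z
        using that R by (cases "z \<in> W") (simp_all add: g_def W_def)
      have "\<rho>' x0 x + \<rho>' x0 y \<le> g x + g y"
        using True
      proof
        assume "x \<in> W"
        from inW[OF this] le[OF xy(2)] show ?thesis by linarith
      next
        assume "y \<in> W"
        from inW[OF this] le[OF xy(1)] show ?thesis by linarith
      qed
      then show ?thesis using ff[OF xy] S0 e by linarith
    next
      case False
      then obtain i where i: "i < N" "x \<in> B i" using xy by (auto simp: W_def Z1_def)
      have notZ: "x \<notin> Z i" "y \<notin> Z i" and le: "\<rho>' x0 x \<le> R" "\<rho>' x0 y \<le> R"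
        using False i(1) xy by (auto simp: W_def Z1_def)
      show ?thesis
      proof (cases "y \<in> B i")
        case True
        have "\<rho>' x y \<le> \<rho>' x (s i) + \<rho>' (s i) y" "\<rho>' x (s i) = \<rho>' (s i) x"
          using semimetric_onD(4)[OF sm' xy(1) ssp xy(2)] semimetric_onD(2)[OF sm' xy(1) ssp] by this+
        then have "\<rho>' x y \<le> e" using True i(2) by (simp add: B_def)
        then show ?thesis using S0 g0[OF xy(1)] g0[OF xy(2)] by linarith
      next
        case False
        then obtain k where k: "k \<in> {- int (K i)..int (K i)}" "\<eta> i \<le> \<rho> (U k x) (U k y)"
          using sep[of x i y] notZ xy i(2) by auto
        have "k \<in> {- int K0..int K0}" using k(1) K0[OF i(1)] by auto
        then have "\<rho> (U k x) (U k y) \<le> ?S"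
          using pos unfolding U_def by (intro member_le_sum) auto
        then have "\<eta>0 \<le> ?S" using k(2) \<eta>0(2)[OF i(1)] by linarith
        then have "C * \<eta>0 \<le> C * ?S" using C by (rule mult_left_mono)
        moreover have "C * \<eta>0 = 2 * R" using \<eta>0(1) by (simp add: C_def)
        ultimately show ?thesis using le ff[OF xy] e g0[OF xy(1)] g0[OF xy(2)] by linarith
      qed
    qed
  qed
qed

section \<open>From the pointwise bound to averages along orbits\<close>

lemma obtain_full_measure:
  assumes "AE x in M. P x"
  obtains W where "full_measure M W" "\<And>x. x \<in> W \<Longrightarrow> P x"
proof -
  obtain N where N: "{x \<in> space M. \<not> P x} \<subseteq> N" "emeasure M N = 0" "N \<in> sets M"
    using AE_E[OF assms] by blast
  show thesis
  proof (rule that[of "space M - N"])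
    have "space M - (space M - N) = N" using sets.sets_into_space[OF N(3)] by auto
    then show "full_measure M (space M - N)" using N by (simp add: full_measure_def)
  qed (use N in auto)
qed

lemma measure_preserving_map_integral:
  fixes h :: "'a \<Rightarrow> real"
  assumes f: "measure_preserving_map M f" and h: "integrable M h"
  shows "integrable M (\<lambda>x. h (f x))" "(\<integral>x. h (f x) \<partial>M) = (\<integral>x. h x \<partial>M)"
proof -
  have m: "f \<in> M \<rightarrow>\<^sub>M M" "distr M M f = M" using f by (auto simp: measure_preserving_map_def)
  have hm: "h \<in> borel_measurable M" using h by auto
  show "integrable M (\<lambda>x. h (f x))"
    using integrable_distr[OF m(1), of h] h m(2) by simp
  show "(\<integral>x. h (f x) \<partial>M) = (\<integral>x. h x \<partial>M)"
    using integral_distr[OF m(1) hm] m(2) by simp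
qed

lemma average_semimetric_eq:
  "average_semimetric M T n \<rho> x y = (\<Sum>k<n. \<rho> ((T ^^ k) x) ((T ^^ k) y)) / real n"
  by (simp add: average_semimetric_def shift_semimetric_def int_iterate_def)

lemma sum_window_le:
  fixes r :: "nat \<Rightarrow> real"
  assumes "\<And>j. 0 \<le> r j" and "l \<le> m"
  shows "(\<Sum>j<n. r (j + l)) \<le> (\<Sum>j<n. r j) + (\<Sum>j<m. r (n + j))"
proof -
  have "(\<Sum>j<n. r (j + l)) = sum r {l..<n + l}"
    using sum.shift_bounds_nat_ivl[of r 0 l n] by (simp add: lessThan_atLeast0)
  also have "\<dots> \<le> sum r {..<n + m}"
    using assms by (intro sum_mono2) auto
  also have "\<dots> = (\<Sum>j<n. r j) + (\<Sum>j<m. r (n + j))"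
    by (induction m) (simp_all add: algebra_simps)
  finally show ?thesis .
qed

text \<open>The bound \<open>le\<close> is available from time \<open>K\<close> on, where all the
  times involved are nonnegative; the first \<open>K\<close> terms of \<open>r'\<close> are
  estimated by \<open>a\<close> instead. Each of the \<open>2 * K + 1\<close> shifts of the sum of
  \<open>r\<close> leaves the window by at most \<open>2 * K\<close> terms, which are estimated by
  \<open>b\<close>.\<close>

lemma sum_shift_comparison:
  fixes r r' a b c :: "nat \<Rightarrow> real" and C e :: real and K n :: nat
  assumes C: "C \<ge> 0" and r: "\<And>j. 0 \<le> r j" "\<And>j. r j \<le> b j" and r': "\<And>j. 0 \<le> r' j" "\<And>j. r' j \<le> a j"
    and le: "\<And>j. r' (K + j) \<le> C * (\<Sum>k\<in>{- int K..int K}. r (nat (k + int (K + j)))) + c (K + j) + e"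
  shows "(\<Sum>j<n. r' j) \<le> C * (2 * real K + 1) * (\<Sum>j<n. r j) + (\<Sum>j<K. a j)
    + C * (2 * real K + 1) * (\<Sum>j<2 * K. b (n + j)) + (\<Sum>j<n. c (K + j)) + n * e"
proof -
  have reindex: "(\<Sum>k\<in>{- int K..int K}. r (nat (k + int (K + j)))) = (\<Sum>l\<le>2 * K. r (j + l))" for j
    by (rule sum.reindex_bij_witness[of _ "\<lambda>l. int l - int K" "\<lambda>k. nat (k + int K)"])
      (auto simp: nat_add_distrib algebra_simps intro!: arg_cong[of _ _ r])
  \<comment> \<open>Lengthening the sum by \<open>K\<close> terms leaves exactly \<open>n\<close>
    terms after the first \<open>K\<close> are split off.\<close>
  have "(\<Sum>j<n. r' j) \<le> (\<Sum>j<K + n. r' j)"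
    using r' by (intro sum_mono2) auto
  also have "\<dots> = (\<Sum>j<K. r' j) + (\<Sum>j<n. r' (K + j))"
    by (induction n) (simp_all add: algebra_simps)
  also have "\<dots> \<le> (\<Sum>j<K. a j) + (\<Sum>j<n. C * (\<Sum>l\<le>2 * K. r (j + l)) + c (K + j) + e)"
    using r' le unfolding reindex by (intro add_mono sum_mono) auto
  also have "(\<Sum>j<n. C * (\<Sum>l\<le>2 * K. r (j + l)) + c (K + j) + e)
      = C * (\<Sum>j<n. \<Sum>l\<le>2 * K. r (j + l)) + (\<Sum>j<n. c (K + j)) + n * e"
    by (simp add: sum.distrib sum_distrib_left)
  also have "(\<Sum>j<n. \<Sum>l\<le>2 * K. r (j + l)) = (\<Sum>l\<le>2 * K. \<Sum>j<n. r (j + l))"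
    by (rule sum.swap)
  also have "C * (\<Sum>l\<le>2 * K. \<Sum>j<n. r (j + l)) \<le> C * (\<Sum>l\<le>2 * K. (\<Sum>j<n. r j) + (\<Sum>j<2 * K. b (n + j)))"
  proof (intro mult_left_mono sum_mono C)
    fix l assume "l \<in> {..2 * K}"
    then have "(\<Sum>j<n. r (j + l)) \<le> (\<Sum>j<n. r j) + (\<Sum>j<2 * K. r (n + j))"
      using r by (intro sum_window_le) auto
    also have "\<dots> \<le> (\<Sum>j<n. r j) + (\<Sum>j<2 * K. b (n + j))"
      using r by (intro add_left_mono sum_mono)
    finally show "(\<Sum>j<n. r (j + l)) \<le> (\<Sum>j<n. r j) + (\<Sum>j<2 * K. b (n + j))" .
  qed
  also have "C * (\<Sum>l\<le>2 * K. (\<Sum>j<n. r j) + (\<Sum>j<2 * K. b (n + j)))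
      = C * (2 * real K + 1) * (\<Sum>j<n. r j) + C * (2 * real K + 1) * (\<Sum>j<2 * K. b (n + j))"
    by (simp add: algebra_simps)
  finally show ?thesis by simp
qed

text \<open>The pointwise bound is summed along the orbit. All errors split into a function of
  \<open>x\<close> plus the same function of \<open>y\<close>, so they fit into one
  \<open>G\<close>. By invariance of the measure, the average of \<open>g\<close> keeps the integral
  of \<open>g\<close>, while the boundary terms have integral \<open>I / n\<close>, at most
  \<open>e\<close> for large \<open>n\<close>.\<close>

lemma average_semimetric_comparison:
  assumes std: "standard_prob_space M" and T: "automorphism_mod0 M T"
    and \<rho>: "admissible M \<rho>" "summable_semimetric M \<rho>" "generating M T \<rho>"
    and \<rho>': "admissible M \<rho>'" "summable_semimetric M \<rho>'" and e: "e > 0"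
  obtains C N W where "C \<ge> 0" "full_measure M W"
    "\<And>n. n \<ge> N \<Longrightarrow> \<exists>G. integrable M G \<and> (\<forall>x\<in>space M. 0 \<le> G x) \<and> (\<integral>x. G x \<partial>M) \<le> 2 * e \<and>
       (\<forall>x\<in>W. \<forall>y\<in>W. average_semimetric M T n \<rho>' x y \<le> C * average_semimetric M T n \<rho> x y + G x + G y + e)"
proof -
  note M = standard_prob_spaceD[OF std]
  have sm: "semimetric_on (space M) \<rho>" and sm': "semimetric_on (space M) \<rho>'"
    and ms: "measurable_semimetric M \<rho>" "measurable_semimetric M \<rho>'"
    using \<rho> \<rho>' by (auto simp: admissible_def measurable_semimetric_def)
  obtain x0 where x0: "x0 \<in> space M" and f: "integrable M (\<rho> x0)"
    by (rule summable_semimetric_integrable_section[OF M ms(1) \<rho>(2)])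
  obtain x1 where x1: "x1 \<in> space M" and f': "integrable M (\<rho>' x1)"
    by (rule summable_semimetric_integrable_section[OF M ms(2) \<rho>'(2)])
  have mp: "measure_preserving_map M (T ^^ j)" for j
    using T by (intro measure_preserving_map_funpow) (simp add: automorphism_mod0_def)
  have Tsp: "(T ^^ j) x \<in> space M" if "x \<in> space M" for j x
    using mp[of j] measurable_space[of "T ^^ j" M M x] that by (auto simp: measure_preserving_map_def)
  obtain K C g where C: "C \<ge> 0" and g: "integrable M g" "\<And>x. x \<in> space M \<Longrightarrow> 0 \<le> g x" "(\<integral>x. g x \<partial>M) \<le> e"
    and lip: "\<And>x y. x \<in> space M \<Longrightarrow> y \<in> space M \<Longrightarrow>
       \<rho>' x y \<le> C * (\<Sum>k\<in>{- int K..int K}. \<rho> (int_iterate M T k x) (int_iterate M T k y)) + g x + g y + e"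
    by (rule lipschitz_up_to_small_error[OF std T \<rho>(1,3) \<rho>' e]) blast
  have "AE x in M. int_iterate M T k ((T ^^ (K + j)) x) = (T ^^ nat (k + int (K + j))) x"
    if "k \<in> {- int K..int K}" for k j
    by (rule AE_int_iterate_funpow[OF T]) (use that in auto)
  \<comment> \<open>Only countably many pairs \<open>(k, j)\<close> occur, so one null set serves
    them all, and \<open>W\<close> depends neither on \<open>n\<close> nor on the pair of
    points.\<close>
  then have "AE x in M. \<forall>k\<in>{- int K..int K}. \<forall>j.
      int_iterate M T k ((T ^^ (K + j)) x) = (T ^^ nat (k + int (K + j))) x"
    by (simp add: AE_ball_countable AE_all_countable)
  then have "AE x in M. x \<in> space M \<and> (\<forall>k\<in>{- int K..int K}. \<forall>j.
      int_iterate M T k ((T ^^ (K + j)) x) = (T ^^ nat (k + int (K + j))) x)"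
    using AE_space by eventually_elim blast
  then obtain W where W: "full_measure M W" "\<And>x. x \<in> W \<Longrightarrow> x \<in> space M"
    and iter: "\<And>x k j. x \<in> W \<Longrightarrow> k \<in> {- int K..int K} \<Longrightarrow>
      int_iterate M T k ((T ^^ (K + j)) x) = (T ^^ nat (k + int (K + j))) x"
    by (rule obtain_full_measure) blast
  define C' where "C' = C * (2 * real K + 1)"
  have C': "C' \<ge> 0" using C by (simp add: C'_def)
  \<comment> \<open>This is the integral of the boundary terms before division by \<open>n\<close>;
    it does not depend on \<open>n\<close>, because every iterate preserves the measure.\<close>
  define I where "I = real K * (\<integral>x. \<rho>' x1 x \<partial>M) + C' * (2 * real K * (\<integral>x. \<rho> x0 x \<partial>M))"
  obtain N where N: "I / e \<le> real N" using real_arch_simple by blast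
  show thesis
  \<comment> \<open>The bound \<open>Suc N\<close> ensures that \<open>n\<close> is positive, so
    that multiplying and dividing by \<open>n\<close> is harmless.\<close>
  proof (rule that[OF C' W(1), of "Suc N"])
    fix n assume n: "n \<ge> Suc N"
    then have n0: "real n > 0" by simp
    define G where "G x = ((\<Sum>j<K. \<rho>' x1 ((T ^^ j) x)) + C' * (\<Sum>j<2 * K. \<rho> x0 ((T ^^ (n + j)) x))
       + (\<Sum>j<n. g ((T ^^ (K + j)) x))) / real n" for x
    note mpi = measure_preserving_map_integral[OF mp]
    have int: "integrable M (\<lambda>x. \<Sum>j<K. \<rho>' x1 ((T ^^ j) x))"
      "integrable M (\<lambda>x. C' * (\<Sum>j<2 * K. \<rho> x0 ((T ^^ (n + j)) x)))"
      "integrable M (\<lambda>x. \<Sum>j<n. g ((T ^^ (K + j)) x))"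
      by (intro Bochner_Integration.integrable_sum integrable_mult_right mpi f f' g)+
    have "integrable M G"
      unfolding G_def by (intro integrable_divide Bochner_Integration.integrable_add int)
    moreover have "0 \<le> G x" if "x \<in> space M" for x
      unfolding G_def using semimetric_onD(1)[OF sm x0 Tsp[OF that]] semimetric_onD(1)[OF sm' x1 Tsp[OF that]]
        g(2)[OF Tsp[OF that]] C'
      by (intro divide_nonneg_nonneg add_nonneg_nonneg mult_nonneg_nonneg sum_nonneg) auto
    moreover have "(\<integral>x. G x \<partial>M) \<le> 2 * e"
    proof -
      have "(\<integral>x. G x \<partial>M) = (I + real n * (\<integral>x. g x \<partial>M)) / real n"
        unfolding G_def using int
        by (simp add: Bochner_Integration.integral_sum mpi f f' g I_def)
      also have "\<dots> = I / real n + (\<integral>x. g x \<partial>M)" using n0 by (simp add: field_simps)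
      also have "I / real n \<le> e"
      proof -
        have "I \<le> real N * e" using N e by (simp add: field_simps)
        also have "\<dots> \<le> real n * e" using n e by (intro mult_right_mono) auto
        finally show ?thesis using n0 by (simp add: field_simps)
      qed
      finally show ?thesis using g(3) by simp
    qed
    moreover have "average_semimetric M T n \<rho>' x y \<le> C' * average_semimetric M T n \<rho> x y + G x + G y + e"
      if xy: "x \<in> W" "y \<in> W" for x y
    proof -
      note sp = Tsp[OF W(2)[OF xy(1)]] Tsp[OF W(2)[OF xy(2)]]
      define r where "r j = \<rho> ((T ^^ j) x) ((T ^^ j) y)" for j
      define r' where "r' j = \<rho>' ((T ^^ j) x) ((T ^^ j) y)" for j
      define a where "a j = \<rho>' x1 ((T ^^ j) x) + \<rho>' x1 ((T ^^ j) y)" for j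
      define b where "b j = \<rho> x0 ((T ^^ j) x) + \<rho> x0 ((T ^^ j) y)" for j
      define c where "c j = g ((T ^^ j) x) + g ((T ^^ j) y)" for j
      have "(\<Sum>j<n. r' j) \<le> C * (2 * real K + 1) * (\<Sum>j<n. r j) + (\<Sum>j<K. a j)
        + C * (2 * real K + 1) * (\<Sum>j<2 * K. b (n + j)) + (\<Sum>j<n. c (K + j)) + n * e"
      proof (rule sum_shift_comparison[OF C])
        fix j
        show "0 \<le> r j" "0 \<le> r' j"
          unfolding r_def r'_def using semimetric_onD(1)[OF sm sp] semimetric_onD(1)[OF sm' sp] by auto
        show "r j \<le> b j"
          using semimetric_onD(4)[OF sm sp(1) x0 sp(2), of j j] semimetric_onD(2)[OF sm sp(1) x0, of j]
          by (simp add: r_def b_def)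
        show "r' j \<le> a j"
          using semimetric_onD(4)[OF sm' sp(1) x1 sp(2), of j j] semimetric_onD(2)[OF sm' sp(1) x1, of j]
          by (simp add: r'_def a_def)
        have "r' (K + j) \<le> C * (\<Sum>k\<in>{- int K..int K}. \<rho> (int_iterate M T k ((T ^^ (K + j)) x))
            (int_iterate M T k ((T ^^ (K + j)) y))) + g ((T ^^ (K + j)) x) + g ((T ^^ (K + j)) y) + e"
          unfolding r'_def by (rule lip[OF sp])
        also have "(\<Sum>k\<in>{- int K..int K}. \<rho> (int_iterate M T k ((T ^^ (K + j)) x))
            (int_iterate M T k ((T ^^ (K + j)) y))) = (\<Sum>k\<in>{- int K..int K}. r (nat (k + int (K + j))))"
          unfolding r_def by (intro sum.cong refl) (simp only: iter[OF xy(1)] iter[OF xy(2)])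
        finally show "r' (K + j) \<le> C * (\<Sum>k\<in>{- int K..int K}. r (nat (k + int (K + j)))) + c (K + j) + e"
          by (simp add: c_def)
      qed
      also have "\<dots> = C' * (\<Sum>j<n. r j) + real n * G x + real n * G y + real n * e"
        using n0 by (simp add: G_def a_def b_def c_def sum.distrib C'_def field_simps)
      finally have "(\<Sum>j<n. r' j) / real n
          \<le> (C' * (\<Sum>j<n. r j) + real n * G x + real n * G y + real n * e) / real n"
        using n0 by (intro divide_right_mono) auto
      also have "\<dots> = C' * ((\<Sum>j<n. r j) / real n) + G x + G y + e"
        using n0 by (simp add: field_simps)
      finally show ?thesis by (simp add: average_semimetric_eq r_def r'_def)
    qed
    ultimately show "\<exists>G. integrable M G \<and> (\<forall>x\<in>space M. 0 \<le> G x) \<and> (\<integral>x. G x \<partial>M) \<le> 2 * e \<and>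
       (\<forall>x\<in>W. \<forall>y\<in>W. average_semimetric M T n \<rho>' x y \<le> C' * average_semimetric M T n \<rho> x y + G x + G y + e)"
      by blast
  qed
qed

section \<open>Comparison of entropies\<close>

lemma less_of_semimetric_diameter_less:
  assumes "semimetric_diameter \<sigma> A < ennreal d" "x \<in> A" "y \<in> A"
  shows "\<sigma> x y < d"
proof (rule ccontr)
  assume "\<not> \<sigma> x y < d"
  then have "ennreal d \<le> ennreal (\<sigma> x y)" by (intro ennreal_leI) simp
  also have "\<dots> \<le> semimetric_diameter \<sigma> A"
    unfolding semimetric_diameter_def using assms(2,3) by (intro SUP_upper2[of "(x, y)"]) auto
  finally show False using assms(1) by simp
qed

lemma semimetric_diameter_le:
  assumes "\<And>x y. x \<in> A \<Longrightarrow> y \<in> A \<Longrightarrow> \<sigma> x y \<le> d"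
  shows "semimetric_diameter \<sigma> A \<le> ennreal d"
  unfolding semimetric_diameter_def using assms by (intro SUP_least) (auto intro: ennreal_leI)

lemma eps_entropy_le:
  assumes "\<And>k X. eps_partition M \<sigma> \<delta> k X \<Longrightarrow> \<exists>Y. eps_partition M \<sigma>' \<epsilon> k Y"
  shows "eps_entropy M \<sigma>' \<epsilon> \<le> eps_entropy M \<sigma> \<delta>"
proof (cases "\<exists>k\<ge>1. \<exists>X. eps_partition M \<sigma> \<delta> k X")
  case True
  let ?P = "\<lambda>k. k \<ge> 1 \<and> (\<exists>X. eps_partition M \<sigma> \<delta> k X)"
  let ?Q = "\<lambda>k. k \<ge> 1 \<and> (\<exists>X. eps_partition M \<sigma>' \<epsilon> k X)"
  have "?P (LEAST k. ?P k)" using True by (rule LeastI_ex)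
  then have *: "?Q (LEAST k. ?P k)" using assms by blast
  then have "(LEAST k. ?Q k) \<le> (LEAST k. ?P k)" by (rule Least_le)
  moreover have "?Q (LEAST k. ?Q k)" using * by (rule LeastI)
  ultimately have "log 2 (real (LEAST k. ?Q k)) \<le> log 2 (real (LEAST k. ?P k))"
    by (intro log_mono) auto
  moreover have "\<exists>k\<ge>1. \<exists>X. eps_partition M \<sigma>' \<epsilon> k X" using * by blast
  ultimately show ?thesis using True by (simp add: eps_entropy_def)
next
  case False
  have "eps_entropy M \<sigma> \<delta> = \<infinity>" unfolding eps_entropy_def by (rule if_not_P[OF False])
  then show ?thesis by simp
qed

lemma eps_entropy_antimono:
  assumes "\<delta> \<le> \<epsilon>"
  shows "eps_entropy M \<sigma> \<epsilon> \<le> eps_entropy M \<sigma> \<delta>"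
proof (rule eps_entropy_le)
  fix k X assume "eps_partition M \<sigma> \<delta> k X"
  then show "\<exists>Y. eps_partition M \<sigma> \<epsilon> k Y"
    using ennreal_leI[OF assms] unfolding eps_partition_def
    by (intro exI[of _ X]) (auto intro: less_le_trans)
qed

text \<open>The points where \<open>G\<close> is large, few by Markov's inequality, and those
  outside \<open>W\<close> are moved into the exceptional piece. The number of pieces stays the
  same; a piece may become empty, which only lowers its diameter to 0. On the remaining pieces the
  new distance is at most \<open>C * \<delta> + 3 * \<epsilon> / 8\<close>.\<close>

lemma (in prob_space) eps_partition_transfer:
  assumes P: "eps_partition M \<sigma> \<delta> k X" and W: "full_measure M W"
    and le: "\<And>x y. x \<in> W \<Longrightarrow> y \<in> W \<Longrightarrow> \<sigma>' x y \<le> C * \<sigma> x y + G x + G y + e"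
    and G: "integrable M G" "\<And>x. x \<in> space M \<Longrightarrow> 0 \<le> G x" "(\<integral>x. G x \<partial>M) \<le> 2 * e"
    and C: "C \<ge> 0" and \<epsilon>: "\<epsilon> > 0" and e: "e \<le> \<epsilon> / 8" "e \<le> \<epsilon>\<^sup>2 / 64"
    and \<delta>: "\<delta> > 0" "\<delta> \<le> \<epsilon> / 2" "C * \<delta> \<le> \<epsilon> / 4"
  shows "\<exists>Y. eps_partition M \<sigma>' \<epsilon> k Y"
proof -
  have Gm [measurable]: "G \<in> borel_measurable M" using G by auto
  have Wm [measurable]: "W \<in> sets M" using W by (simp add: full_measure_def)
  have Xm: "\<And>j. j \<le> k \<Longrightarrow> X j \<in> sets M" and disj: "disjoint_family_on X {..k}"
    and cover: "(\<Union>j\<le>k. X j) = space M" and X0: "emeasure M (X 0) < ennreal \<delta>"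
    and diam: "\<And>j. j \<in> {1..k} \<Longrightarrow> semimetric_diameter \<sigma> (X j) < ennreal \<delta>"
    using P by (auto simp: eps_partition_def)
  \<comment> \<open>With this threshold Markov's inequality gives the bound
    \<open>2 * e / (\<epsilon> / 8)\<close>, and \<open>e \<le> \<epsilon>\<^sup>2 / 64\<close>
    makes it at most \<open>\<epsilon> / 4\<close>.\<close>
  define B where "B = {x \<in> space M. \<epsilon> / 8 \<le> G x} \<union> (space M - W)"
  have B [measurable]: "B \<in> sets M" unfolding B_def by measurable
  have Bm: "measure M B \<le> \<epsilon> / 4"
  proof -
    have "measure M {x \<in> space M. \<epsilon> / 8 \<le> G x} \<le> (\<integral>x. G x \<partial>M) / (\<epsilon> / 8)"
      using G \<epsilon> by (intro integral_Markov_inequality_measure[where A = "{}"]) auto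
    also have "\<dots> \<le> (\<epsilon>\<^sup>2 / 32) / (\<epsilon> / 8)"
      using G(3) e \<epsilon> by (intro divide_right_mono) auto
    also have "\<dots> = \<epsilon> / 4" using \<epsilon> by (simp add: power2_eq_square)
    finally have "measure M {x \<in> space M. \<epsilon> / 8 \<le> G x} \<le> \<epsilon> / 4" .
    moreover have "measure M (space M - W) = 0" using W by (simp add: full_measure_def measure_def)
    moreover have "measure M B \<le> measure M {x \<in> space M. \<epsilon> / 8 \<le> G x} + measure M (space M - W)"
      unfolding B_def by (intro measure_Un_le) auto
    ultimately show ?thesis by simp
  qed
  define Y where "Y j = (if j = 0 then X 0 \<union> B else X j - B)" for j
  have "eps_partition M \<sigma>' \<epsilon> k Y"
    unfolding eps_partition_def
  proof (intro conjI allI ballI impI)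
    show "Y j \<in> sets M" if "j \<le> k" for j using Xm[OF that] Xm[of 0] by (auto simp: Y_def)
    show "disjoint_family_on Y {..k}"
    proof (unfold disjoint_family_on_def, intro ballI impI)
      fix i j assume "i \<in> {..k}" "j \<in> {..k}" "i \<noteq> j"
      then have "X i \<inter> X j = {}" by (rule disjoint_family_onD[OF disj])
      then show "Y i \<inter> Y j = {}" using \<open>i \<noteq> j\<close> unfolding Y_def by (cases "i = 0"; cases "j = 0") auto
    qed
    have Bsp: "B \<subseteq> space M" using sets.sets_into_space[OF B] .
    show "(\<Union>j\<le>k. Y j) = space M"
    proof
      show "(\<Union>j\<le>k. Y j) \<subseteq> space M"
        using sets.sets_into_space[OF Xm] Bsp by (auto simp: Y_def split: if_splits)
      show "space M \<subseteq> (\<Union>j\<le>k. Y j)"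
      proof
        fix x assume "x \<in> space M"
        then obtain j where "j \<le> k" "x \<in> X j" using cover by auto
        then have "x \<in> Y 0 \<or> x \<in> Y j" by (auto simp: Y_def)
        then show "x \<in> (\<Union>j\<le>k. Y j)" using \<open>j \<le> k\<close> by auto
      qed
    qed
    have "measure M (X 0) < \<delta>" using X0 \<delta>(1) by (simp add: emeasure_eq_measure ennreal_less_iff)
    moreover have "measure M (Y 0) \<le> measure M (X 0) + measure M B"
      unfolding Y_def using Xm[of 0] by (simp add: measure_Un_le)
    ultimately have "measure M (Y 0) < \<epsilon>" using \<delta>(2) Bm \<epsilon> by linarith
    then show "emeasure M (Y 0) < ennreal \<epsilon>" using \<epsilon> by (simp add: emeasure_eq_measure ennreal_less_iff)
    fix j assume j: "j \<in> {1..k}"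
    \<comment> \<open>The diameter is a supremum, so a bound strictly below
      \<open>\<epsilon>\<close> and uniform in the pair of points is required.\<close>
    have "semimetric_diameter \<sigma>' (Y j) \<le> ennreal (5 * \<epsilon> / 8)"
    proof (rule semimetric_diameter_le)
      fix x y assume "x \<in> Y j" "y \<in> Y j"
      then have xy: "x \<in> X j" "y \<in> X j" "x \<notin> B" "y \<notin> B" using j by (auto simp: Y_def)
      moreover have "X j \<subseteq> space M" using j by (intro sets.sets_into_space Xm) auto
      ultimately have in_W: "x \<in> W" "y \<in> W" and G8: "G x \<le> \<epsilon> / 8" "G y \<le> \<epsilon> / 8" by (auto simp: B_def)
      have "\<sigma> x y < \<delta>" by (rule less_of_semimetric_diameter_less[OF diam[OF j] xy(1,2)])
      then have "C * \<sigma> x y \<le> C * \<delta>" using C by (intro mult_left_mono) auto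
      then show "\<sigma>' x y \<le> 5 * \<epsilon> / 8" using le[OF in_W] G8 e(1) \<delta>(3) by linarith
    qed
    also have "ennreal (5 * \<epsilon> / 8) < ennreal \<epsilon>" using \<epsilon> by (intro ennreal_lessI) auto
    finally show "semimetric_diameter \<sigma>' (Y j) < ennreal \<epsilon>" .
  qed
  then show ?thesis by blast
qed

lemma eps_entropy_average_comparison:
  assumes std: "standard_prob_space M" and T: "automorphism_mod0 M T"
    and \<rho>: "admissible M \<rho>" "summable_semimetric M \<rho>" "generating M T \<rho>"
    and \<rho>': "admissible M \<rho>'" "summable_semimetric M \<rho>'" and \<epsilon>: "\<epsilon> > 0"
  obtains \<delta> N where "\<delta> > 0" "\<And>n. n \<ge> N \<Longrightarrow>
    eps_entropy M (average_semimetric M T n \<rho>') \<epsilon> \<le> eps_entropy M (average_semimetric M T n \<rho>) \<delta>"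
proof -
  interpret prob_space M by (rule standard_prob_spaceD[OF std])
  \<comment> \<open>The first bound controls the additive error in the diameters, the second the
    measure of the exceptional piece.\<close>
  define e where "e = min (\<epsilon> / 8) (\<epsilon>\<^sup>2 / 64)"
  have e: "e > 0" "e \<le> \<epsilon> / 8" "e \<le> \<epsilon>\<^sup>2 / 64" using \<epsilon> by (auto simp: e_def)
  obtain C N W where C: "C \<ge> 0" and W: "full_measure M W"
    and cmp: "\<And>n. n \<ge> N \<Longrightarrow> \<exists>G. integrable M G \<and> (\<forall>x\<in>space M. 0 \<le> G x) \<and> (\<integral>x. G x \<partial>M) \<le> 2 * e \<and>
       (\<forall>x\<in>W. \<forall>y\<in>W. average_semimetric M T n \<rho>' x y \<le> C * average_semimetric M T n \<rho> x y + G x + G y + e)"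
    by (rule average_semimetric_comparison[OF std T \<rho> \<rho>' e(1)]) blast
  \<comment> \<open>Writing \<open>C + 1\<close> in the denominator allows for \<open>C = 0\<close>
    and still gives \<open>C * \<delta> \<le> \<epsilon> / 4\<close>.\<close>
  define \<delta> where "\<delta> = min (\<epsilon> / 2) (\<epsilon> / (4 * (C + 1)))"
  have \<delta>: "\<delta> > 0" "\<delta> \<le> \<epsilon> / 2" using \<epsilon> C unfolding \<delta>_def by (simp, intro min.cobounded1)
  have "C * \<delta> \<le> (C + 1) * (\<epsilon> / (4 * (C + 1)))"
    using C \<delta>(1) by (intro mult_mono) (auto simp: \<delta>_def)
  also have "\<dots> = \<epsilon> / 4" using C by (simp add: field_simps)
  finally have C\<delta>: "C * \<delta> \<le> \<epsilon> / 4" .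
  show thesis
  proof (rule that[OF \<delta>(1)])
    fix n assume "n \<ge> N"
    from cmp[OF this] obtain G where G: "integrable M G" "\<And>x. x \<in> space M \<Longrightarrow> 0 \<le> G x" "(\<integral>x. G x \<partial>M) \<le> 2 * e"
      and le: "\<And>x y. x \<in> W \<Longrightarrow> y \<in> W \<Longrightarrow>
        average_semimetric M T n \<rho>' x y \<le> C * average_semimetric M T n \<rho> x y + G x + G y + e"
      by blast
    show "eps_entropy M (average_semimetric M T n \<rho>') \<epsilon> \<le> eps_entropy M (average_semimetric M T n \<rho>) \<delta>"
      by (rule eps_entropy_le) (rule eps_partition_transfer[OF _ W le G C \<epsilon> e(2,3) \<delta> C\<delta>])
  qed
qed

text \<open>The upper bounds for \<open>\<rho>'\<close> follow from bounding its entropy by that of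
  \<open>\<rho>\<close>. The lower bounds use the comparison with the roles exchanged, which is
  where \<open>\<rho>'\<close> has to be generating.\<close>

lemma scaling_sequences_subset:
  assumes std: "standard_prob_space M" and T: "automorphism_mod0 M T"
    and \<rho>: "admissible M \<rho>" "summable_semimetric M \<rho>" "generating M T \<rho>"
    and \<rho>': "admissible M \<rho>'" "summable_semimetric M \<rho>'" "generating M T \<rho>'"
  shows "scaling_sequences M T \<rho> \<subseteq> scaling_sequences M T \<rho>'"
proof
  fix h assume h: "h \<in> scaling_sequences M T \<rho>"
  define H where "H \<sigma> \<epsilon> = (\<lambda>n. eps_entropy M (average_semimetric M T n \<sigma>) \<epsilon> / ereal (h n))" for \<sigma> \<epsilon>
  have hpos: "\<And>n. n \<ge> 1 \<Longrightarrow> 0 < h n" and up: "\<And>\<epsilon>. \<epsilon> > 0 \<Longrightarrow> limsup (H \<rho> \<epsilon>) < \<infinity>"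
    and low: "\<forall>\<^sub>F \<epsilon> in at_right 0. liminf (H \<rho> \<epsilon>) > 0"
    using h by (auto simp: scaling_sequences_def H_def)
  have H_le: "\<forall>\<^sub>F n in sequentially. H \<sigma>' \<epsilon> n \<le> H \<sigma> \<delta> n"
    if "\<And>n. n \<ge> N \<Longrightarrow>
      eps_entropy M (average_semimetric M T n \<sigma>') \<epsilon> \<le> eps_entropy M (average_semimetric M T n \<sigma>) \<delta>"
    for \<sigma> \<sigma>' \<epsilon> \<delta> N
    unfolding eventually_sequentially
  proof (intro exI allI impI)
    \<comment> \<open>Division by \<open>h n\<close> is monotone because \<open>h n\<close> is
      positive, which is guaranteed from index 1 on.\<close>
    fix n assume "max 1 N \<le> n"
    then show "H \<sigma>' \<epsilon> n \<le> H \<sigma> \<delta> n"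
      unfolding H_def using hpos[of n] that by (intro ereal_divide_right_mono) auto
  qed
  have "limsup (H \<rho>' \<epsilon>) < \<infinity>" if \<epsilon>: "\<epsilon> > 0" for \<epsilon>
  proof -
    obtain \<delta> N where "\<delta> > 0" and le: "\<And>n. n \<ge> N \<Longrightarrow>
      eps_entropy M (average_semimetric M T n \<rho>') \<epsilon> \<le> eps_entropy M (average_semimetric M T n \<rho>) \<delta>"
      by (rule eps_entropy_average_comparison[OF std T \<rho> \<rho>'(1,2) \<epsilon>]) blast
    have "limsup (H \<rho>' \<epsilon>) \<le> limsup (H \<rho> \<delta>)" by (rule Limsup_mono[OF H_le[OF le]])
    also have "\<dots> < \<infinity>" by (rule up) fact
    finally show ?thesis .
  qed
  moreover have "\<forall>\<^sub>F \<epsilon> in at_right 0. liminf (H \<rho>' \<epsilon>) > 0"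
  proof -
    have "\<forall>\<^sub>F \<epsilon> in at_right (0::real). \<epsilon> > 0" by (rule eventually_at_right_less)
    \<comment> \<open>A single good value for \<open>\<rho>\<close> is enough. It yields
      \<open>\<delta>\<close> for \<open>\<rho>'\<close>, and as entropy grows when its parameter
      decreases, every value below \<open>\<delta>\<close> is good as well.\<close>
    then obtain \<epsilon> where \<epsilon>: "\<epsilon> > 0" "liminf (H \<rho> \<epsilon>) > 0"
      using eventually_happens[OF eventually_conj[OF low]] by (metis trivial_limit_at_right_real)
    obtain \<delta> N where \<delta>: "\<delta> > 0" and le: "\<And>n. n \<ge> N \<Longrightarrow>
      eps_entropy M (average_semimetric M T n \<rho>) \<epsilon> \<le> eps_entropy M (average_semimetric M T n \<rho>') \<delta>"
      by (rule eps_entropy_average_comparison[OF std T \<rho>' \<rho>(1,2) \<epsilon>(1)]) blast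
    have "liminf (H \<rho>' \<epsilon>') > 0" if "\<epsilon>' \<le> \<delta>" for \<epsilon>'
    proof -
      note \<epsilon>(2)
      also have "liminf (H \<rho> \<epsilon>) \<le> liminf (H \<rho>' \<epsilon>')"
        by (rule Liminf_mono[OF H_le]) (rule order_trans[OF le eps_entropy_antimono[OF that]])
      finally show ?thesis .
    qed
    then show ?thesis
      using \<delta> unfolding eventually_at_right_field by (intro exI[of _ \<delta>]) auto
  qed
  ultimately show "h \<in> scaling_sequences M T \<rho>'"
    using hpos by (auto simp: scaling_sequences_def H_def)
qed

theorem theorem1:
  fixes M :: "'a measure" and T :: "'a \<Rightarrow> 'a" and \<rho> \<rho>' :: "'a \<Rightarrow> 'a \<Rightarrow> real"
  assumes "standard_prob_space M"
    and "automorphism_mod0 M T" and "ergodic M T"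
    and "admissible M \<rho>" and "summable_semimetric M \<rho>" and "generating M T \<rho>"
    and "admissible M \<rho>'" and "summable_semimetric M \<rho>'" and "generating M T \<rho>'"
  shows "scaling_sequences M T \<rho> = scaling_sequences M T \<rho>'"
  using scaling_sequences_subset[OF assms(1,2,4-9)] scaling_sequences_subset[OF assms(1,2,7-9,4-6)]
  by (rule subset_antisym)

end
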